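(* The family $\mathcal{F}$, consisting of all functions $\hat a_x$ with $x$ a finite word in $\{0,1\}$ of length at least $1$, together with $\hat a_\emptyset^0$ and $\hat a_\emptyset^1$, is an orthonormal basis for the kernel of the Ruelle operator $\mathscr{L}_{\log J}$ (acting on $L^2(\mu)$).
   Context: Let $r,s\in(0,1)$, $P=\begin{pmatrix}P_{0,0}&P_{0,1}\\P_{1,0}&P_{1,1}\end{pmatrix}=\begin{pmatrix}r&1-r\\1-s&s\end{pmatrix}$, and let $\pi=(\pi_0,\pi_1)$ be the probability vector with $\pi P=\pi$. On $\{0,1\}^{\mathbb N}$ let $\mu$ be the Markov probability $\mu[x_1,\dots,x_n]=\pi_{x_1}P_{x_1,x_2}\cdots P_{x_{n-1},x_n}$. The Ruelle operator is $\mathscr{L}_{\log J}\varphi(x_1,x_2,\dots)=\sum_{i=0,1}\frac{\pi_iP_{i,x_1}}{\pi_{x_1}}\varphi(i,x_1,x_2,\dots)$. For a finite word $x=(x_1,\dots,x_n)$, $n\ge1$, $[x]$ is its cylinder and $$e_{[x]}=\tfrac{1}{\sqrt{\mu([x])}}\Big(\sqrt{\tfrac{P_{x_n,1}}{P_{x_n,0}}}\,1_{[x0]}-\sqrt{\tfrac{P_{x_n,0}}{P_{x_n,1}}}\,1_{[x1]}\Big),\quad a_x=\sqrt{\tfrac{\pi_{x_1}}{\pi_0P_{0,x_1}}}\,e_{[0x]}-\sqrt{\tfrac{\pi_{x_1}}{\pi_1P_{1,x_1}}}\,e_{[1x]},\quad \hat a_x=\frac{a_x}{|a_x|},$$ with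 $|\cdot|$ the $L^2(\mu)$ norm. Also $V_1=\pi_1P_{1,0}1_{[00]}-\pi_0P_{0,0}1_{[10]}$, $V_2=\pi_0P_{0,1}1_{[11]}-\pi_1P_{1,1}1_{[01]}$, $\hat a_\emptyset^0=V_1/|V_1|$, $\hat a_\emptyset^1=V_2/|V_2|$. Orthonormal basis means complete orthonormal set in the $L^2(\mu)$ sense. *)

theory Defs
  imports "HOL-Probability.Probability"
begin

text \<open>The alphabet \<open>{0,1}\<close> is the numeral type \<open>2\<close>, and \<open>{0,1}\<^sup>\<nat>\<close> is \<open>2 stream\<close>. In the type \<open>2\<close> the
  numerals \<open>0\<close> and \<open>2\<close> denote the same element. Real-valued \<open>L\<^sup>2\<close> functions are represented by
  square-integrable functions, with almost everywhere equality in place of equality.\<close>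

definition trans_mat :: "real \<Rightarrow> real \<Rightarrow> real^2^2" where
  "trans_mat r s = (\<chi> i j. if i = 0 then (if j = 0 then r else 1 - r)
                               else (if j = 0 then 1 - s else s))"

definition stationary :: "real^2^2 \<Rightarrow> real^2 \<Rightarrow> bool" where
  "stationary P \<pi> \<longleftrightarrow> (\<forall>i. 0 \<le> \<pi> $ i) \<and> (\<Sum>i\<in>UNIV. \<pi> $ i) = 1 \<and> \<pi> v* P = \<pi>"

abbreviation cyl :: "2 list \<Rightarrow> 2 stream set" where
  "cyl x \<equiv> sstart UNIV x"

definition markov_measure :: "real^2^2 \<Rightarrow> real^2 \<Rightarrow> 2 stream measure \<Rightarrow> bool" where
  "markov_measure P \<pi> \<mu> \<longleftrightarrow>
     prob_space \<mu> \<and> sets \<mu> = sets (stream_space (count_space UNIV)) \<and>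
     (\<forall>x. x \<noteq> [] \<longrightarrow> measure \<mu> (cyl x) =
        \<pi> $ hd x * (\<Prod>k<length x - 1. P $ (x ! k) $ (x ! Suc k)))"

definition L2 :: "'a measure \<Rightarrow> ('a \<Rightarrow> real) set" where
  "L2 \<mu> = {f \<in> borel_measurable \<mu>. integrable \<mu> (\<lambda>\<omega>. (f \<omega>)\<^sup>2)}"

definition L2_inner :: "'a measure \<Rightarrow> ('a \<Rightarrow> real) \<Rightarrow> ('a \<Rightarrow> real) \<Rightarrow> real" where
  "L2_inner \<mu> f g = (\<integral>\<omega>. f \<omega> * g \<omega> \<partial>\<mu>)"

definition L2_norm :: "'a measure \<Rightarrow> ('a \<Rightarrow> real) \<Rightarrow> real" where
  "L2_norm \<mu> f = sqrt (L2_inner \<mu> f f)"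

text \<open>Completeness is density in \<open>K\<close> of the linear span of the family. The indices make
  orthonormality include that distinct indices give distinct elements.\<close>

definition L2_orthonormal_basis ::
    "'a measure \<Rightarrow> ('a \<Rightarrow> real) set \<Rightarrow> 'i set \<Rightarrow> ('i \<Rightarrow> 'a \<Rightarrow> real) \<Rightarrow> bool" where
  "L2_orthonormal_basis \<mu> K I b \<longleftrightarrow>
     K \<subseteq> L2 \<mu> \<and> (\<forall>i\<in>I. b i \<in> K) \<and>
     (\<forall>i\<in>I. \<forall>j\<in>I. L2_inner \<mu> (b i) (b j) = (if i = j then 1 else 0)) \<and>
     (\<forall>f\<in>K. \<forall>\<epsilon>>0. \<exists>F c. finite F \<and> F \<subseteq> I \<and>
        L2_norm \<mu> (\<lambda>\<omega>. f \<omega> - (\<Sum>i\<in>F. c i * b i \<omega>)) < \<epsilon>)"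

definition ruelle :: "real^2^2 \<Rightarrow> real^2 \<Rightarrow> (2 stream \<Rightarrow> real) \<Rightarrow> 2 stream \<Rightarrow> real" where
  "ruelle P \<pi> \<phi> \<omega> =
     (\<Sum>i\<in>UNIV. \<pi> $ i * P $ i $ shd \<omega> / \<pi> $ shd \<omega> * \<phi> (i ## \<omega>))"

text \<open>For stationary \<open>\<pi>\<close> with positive entries and the Markov measure \<open>\<mu>\<close>, the preimage of a null
  set under \<open>\<omega> \<mapsto> i ## \<omega>\<close> is null, so membership in the kernel depends only on the almost
  everywhere class of \<open>\<phi>\<close>.\<close>

definition ruelle_kernel ::
    "real^2^2 \<Rightarrow> real^2 \<Rightarrow> 2 stream measure \<Rightarrow> (2 stream \<Rightarrow> real) set" where
  "ruelle_kernel P \<pi> \<mu> = {\<phi> \<in> L2 \<mu>. AE \<omega> in \<mu>. ruelle P \<pi> \<phi> \<omega> = 0}"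

definition e_fun :: "real^2^2 \<Rightarrow> 2 stream measure \<Rightarrow> 2 list \<Rightarrow> 2 stream \<Rightarrow> real" where
  "e_fun P \<mu> x \<omega> = 1 / sqrt (measure \<mu> (cyl x)) *
     (sqrt (P $ last x $ 1 / P $ last x $ 0) * indicator (cyl (x @ [0])) \<omega>
      - sqrt (P $ last x $ 0 / P $ last x $ 1) * indicator (cyl (x @ [1])) \<omega>)"

definition a_fun ::
    "real^2^2 \<Rightarrow> real^2 \<Rightarrow> 2 stream measure \<Rightarrow> 2 list \<Rightarrow> 2 stream \<Rightarrow> real" where
  "a_fun P \<pi> \<mu> x \<omega> =
     sqrt (\<pi> $ hd x / (\<pi> $ 0 * P $ 0 $ hd x)) * e_fun P \<mu> (0 # x) \<omega>
     - sqrt (\<pi> $ hd x / (\<pi> $ 1 * P $ 1 $ hd x)) * e_fun P \<mu> (1 # x) \<omega>"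

definition V1 :: "real^2^2 \<Rightarrow> real^2 \<Rightarrow> 2 stream \<Rightarrow> real" where
  "V1 P \<pi> \<omega> = \<pi> $ 1 * P $ 1 $ 0 * indicator (cyl [0, 0]) \<omega>
               - \<pi> $ 0 * P $ 0 $ 0 * indicator (cyl [1, 0]) \<omega>"

definition V2 :: "real^2^2 \<Rightarrow> real^2 \<Rightarrow> 2 stream \<Rightarrow> real" where
  "V2 P \<pi> \<omega> = \<pi> $ 0 * P $ 0 $ 1 * indicator (cyl [1, 1]) \<omega>
               - \<pi> $ 1 * P $ 1 $ 1 * indicator (cyl [0, 1]) \<omega>"

definition L2_normalize :: "'a measure \<Rightarrow> ('a \<Rightarrow> real) \<Rightarrow> 'a \<Rightarrow> real" where
  "L2_normalize \<mu> f \<omega> = f \<omega> / L2_norm \<mu> f"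

definition a_hat ::
    "real^2^2 \<Rightarrow> real^2 \<Rightarrow> 2 stream measure \<Rightarrow> 2 list \<Rightarrow> 2 stream \<Rightarrow> real" where
  "a_hat P \<pi> \<mu> x = L2_normalize \<mu> (a_fun P \<pi> \<mu> x)"

definition a_hat_empty ::
    "real^2^2 \<Rightarrow> real^2 \<Rightarrow> 2 stream measure \<Rightarrow> 2 \<Rightarrow> 2 stream \<Rightarrow> real" where
  "a_hat_empty P \<pi> \<mu> i = L2_normalize \<mu> (if i = 0 then V1 P \<pi> else V2 P \<pi>)"

end

theory Submission imports Defs begin

text \<open>A function \<open>\<phi>\<close> lies in the kernel iff \<open>\<pi>\<^sub>0 P\<^sub>0\<^sub>j \<phi>(0\<omega>) = - \<pi>\<^sub>1 P\<^sub>1\<^sub>j \<phi>(1\<omega>)\<close> with \<open>j = \<omega>\<^sub>1\<close>, that is, iff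
  \<open>\<phi> = T h\<close> where \<open>T h (i\<omega>) = \<plusminus> h(\<omega>) / (\<pi>\<^sub>i P\<^sub>i\<^sub>j)\<close>. Up to nonzero factors, \<open>T\<close> maps \<open>1\<^bsub>[0]\<^esub>\<close>, \<open>1\<^bsub>[1]\<^esub>\<close> and
  \<open>e\<^bsub>[x]\<^esub>\<close> to \<open>V\<^sub>1\<close>, \<open>V\<^sub>2\<close> and \<open>a\<^sub>x\<close>. Since \<open>\<langle>T g, T h\<rangle>\<close> is the integral of \<open>g h\<close> against a positive weight
  depending only on \<open>\<omega>\<^sub>1\<close>, orthogonality is that of the Haar-type system \<open>1\<^bsub>[0]\<^esub>\<close>, \<open>1\<^bsub>[1]\<^esub>\<close>, \<open>e\<^bsub>[x]\<^esub>\<close>, and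
  completeness follows from the density of cylinder functions in \<open>L\<^sup>2(\<mu>)\<close>.\<close>

subsection \<open>Density in \<open>L\<^sup>2\<close> of the indicators of a generator\<close>

text \<open>The coefficient form of the linear span is the one that
  \<open>L2_orthonormal_basis\<close> uses for completeness.\<close>

definition span_fun :: "'i set \<Rightarrow> ('i \<Rightarrow> 'a \<Rightarrow> real) \<Rightarrow> ('a \<Rightarrow> real) set" where
  "span_fun I b = {f. \<exists>F c. finite F \<and> F \<subseteq> I \<and> f = (\<lambda>\<omega>. \<Sum>i\<in>F. c i * b i \<omega>)}"

lemma span_fun_zero: "(\<lambda>\<omega>. 0) \<in> span_fun I b"
  unfolding span_fun_def by (auto intro!: exI[of _ "{}"])

lemma span_fun_scale:
  assumes "f \<in> span_fun I b"
  shows "(\<lambda>\<omega>. k * f \<omega>) \<in> span_fun I b"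
proof -
  obtain F c where "finite F" "F \<subseteq> I" "f = (\<lambda>\<omega>. \<Sum>i\<in>F. c i * b i \<omega>)"
    using assms unfolding span_fun_def by auto
  then show ?thesis
    unfolding span_fun_def
    by (auto intro!: exI[of _ F] exI[of _ "\<lambda>i. k * c i"] simp: sum_distrib_left mult.assoc)
qed

lemma span_fun_add:
  assumes "f \<in> span_fun I b" and "g \<in> span_fun I b"
  shows "(\<lambda>\<omega>. f \<omega> + g \<omega>) \<in> span_fun I b"
proof -
  obtain F c where F: "finite F" "F \<subseteq> I" "f = (\<lambda>\<omega>. \<Sum>i\<in>F. c i * b i \<omega>)"
    using assms(1) unfolding span_fun_def by auto
  obtain G d where G: "finite G" "G \<subseteq> I" "g = (\<lambda>\<omega>. \<Sum>i\<in>G. d i * b i \<omega>)"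
    using assms(2) unfolding span_fun_def by auto
  \<comment> \<open>Each coefficient family is extended by 0 to the common index set, so overlapping
    indices simply add up.\<close>
  let ?c = "\<lambda>i. (if i \<in> F then c i else 0) + (if i \<in> G then d i else 0)"
  have "f \<omega> + g \<omega> = (\<Sum>i\<in>F \<union> G. ?c i * b i \<omega>)" for \<omega>
  proof -
    have "f \<omega> = (\<Sum>i\<in>F \<union> G. (if i \<in> F then c i else 0) * b i \<omega>)"
      unfolding F(3) using F(1) G(1) by (intro sum.mono_neutral_cong_left) auto
    moreover have "g \<omega> = (\<Sum>i\<in>F \<union> G. (if i \<in> G then d i else 0) * b i \<omega>)"
      unfolding G(3) using F(1) G(1) by (intro sum.mono_neutral_cong_left) auto
    ultimately show ?thesis
      by (simp only: distrib_right sum.distrib)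
  qed
  then show ?thesis
    unfolding span_fun_def using F(1,2) G(1,2)
    by (auto intro!: exI[of _ "F \<union> G"] exI[of _ ?c])
qed

lemma span_fun_base: "i \<in> I \<Longrightarrow> b i \<in> span_fun I b"
  unfolding span_fun_def by (auto intro!: exI[of _ "{i}"] exI[of _ "\<lambda>_. 1"])

text \<open>The sum is built up one term at a time. This reduces linear claims about the span to
  scaled generators.\<close>

lemma span_fun_induct [consumes 1, case_names zero add scale]:
  assumes "f \<in> span_fun I b" and "Q (\<lambda>\<omega>. 0)"
    and add: "\<And>f g. Q f \<Longrightarrow> Q g \<Longrightarrow> Q (\<lambda>\<omega>. f \<omega> + g \<omega>)"
    and scale: "\<And>i c. i \<in> I \<Longrightarrow> Q (\<lambda>\<omega>. c * b i \<omega>)"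
  shows "Q f"
proof -
  obtain F c where F: "finite F" "F \<subseteq> I" and f: "f = (\<lambda>\<omega>. \<Sum>i\<in>F. c i * b i \<omega>)"
    using assms(1) unfolding span_fun_def by auto
  from F have "Q (\<lambda>\<omega>. \<Sum>i\<in>F. c i * b i \<omega>)"
    by (induction F) (auto intro: assms(2) add scale)
  then show ?thesis
    by (simp add: f)
qed

text \<open>The product is dominated by the sum of the squares, by the arithmetic-geometric mean
  inequality.\<close>

lemma L2_mult_integrable:
  assumes "f \<in> L2 M" and "g \<in> L2 M"
  shows "integrable M (\<lambda>\<omega>. f \<omega> * g \<omega>)"
proof (rule Bochner_Integration.integrable_bound)
  show "integrable M (\<lambda>\<omega>. (f \<omega>)\<^sup>2 + (g \<omega>)\<^sup>2)"
    using assms by (simp add: L2_def)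
  have "\<bar>x * y\<bar> \<le> x\<^sup>2 + y\<^sup>2" for x y :: real
  proof -
    have "2 * \<bar>x * y\<bar> \<le> x\<^sup>2 + y\<^sup>2"
      using sum_squares_bound[of "\<bar>x\<bar>" "\<bar>y\<bar>"] by (simp add: abs_mult)
    moreover have "0 \<le> \<bar>x * y\<bar>"
      by (rule abs_ge_zero)
    ultimately show ?thesis
      by linarith
  qed
  then show "AE \<omega> in M. norm (f \<omega> * g \<omega>) \<le> norm ((f \<omega>)\<^sup>2 + (g \<omega>)\<^sup>2)"
    by simp
qed (use assms in \<open>auto simp: L2_def\<close>)

lemma L2_add:
  assumes "f \<in> L2 M" and "g \<in> L2 M"
  shows "(\<lambda>\<omega>. f \<omega> + g \<omega>) \<in> L2 M"
  using assms L2_mult_integrable[OF assms]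
  by (auto simp: L2_def power2_sum mult.assoc)

lemma L2_scale: "f \<in> L2 M \<Longrightarrow> (\<lambda>\<omega>. c * f \<omega>) \<in> L2 M"
  by (auto simp: L2_def power_mult_distrib)

lemma L2_diff:
  assumes "f \<in> L2 M" and "g \<in> L2 M"
  shows "(\<lambda>\<omega>. f \<omega> - g \<omega>) \<in> L2 M"
  using L2_add[OF assms(1) L2_scale[OF assms(2), of "-1"]] by simp

lemma span_fun_L2:
  assumes "\<And>i. i \<in> I \<Longrightarrow> b i \<in> L2 M" and "f \<in> span_fun I b"
  shows "f \<in> L2 M"
  using assms(2)
proof (induction rule: span_fun_induct)
  case zero
  show ?case by (simp add: L2_def)
qed (auto intro: L2_add L2_scale assms(1))

lemma (in finite_measure) L2_indicator: "A \<in> sets M \<Longrightarrow> indicator A \<in> L2 M"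
  by (auto simp: L2_def power2_eq_square indicator_inter_arith[symmetric] emeasure_eq_measure)

text \<open>Squared distances avoid roots. Membership in \<open>L2 M\<close> is included because a
  non-integrable square would have integral 0 by convention and pass as small.\<close>

definition sq_approx :: "'a measure \<Rightarrow> ('a \<Rightarrow> real) set \<Rightarrow> ('a \<Rightarrow> real) \<Rightarrow> bool" where
  "sq_approx M S f \<longleftrightarrow> f \<in> L2 M \<and> (\<forall>\<epsilon>>0. \<exists>g\<in>S. (\<integral>\<omega>. (f \<omega> - g \<omega>)\<^sup>2 \<partial>M) < \<epsilon>)"

text \<open>Stands in for the triangle inequality; the pointwise bound is nonnegativity of the
  square of the difference.\<close>

lemma integral_square_add_le:
  assumes "f \<in> L2 M" and "g \<in> L2 M"
  shows "(\<integral>\<omega>. (f \<omega> + g \<omega>)\<^sup>2 \<partial>M) \<le> 2 * (\<integral>\<omega>. (f \<omega>)\<^sup>2 \<partial>M) + 2 * (\<integral>\<omega>. (g \<omega>)\<^sup>2 \<partial>M)"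
proof -
  have "(\<integral>\<omega>. (f \<omega> + g \<omega>)\<^sup>2 \<partial>M) \<le> (\<integral>\<omega>. 2 * (f \<omega>)\<^sup>2 + 2 * (g \<omega>)\<^sup>2 \<partial>M)"
  proof (rule integral_mono)
    show "integrable M (\<lambda>\<omega>. (f \<omega> + g \<omega>)\<^sup>2)"
      using L2_add[OF assms] by (simp add: L2_def)
    show "(f \<omega> + g \<omega>)\<^sup>2 \<le> 2 * (f \<omega>)\<^sup>2 + 2 * (g \<omega>)\<^sup>2" for \<omega>
      using zero_le_power2[of "f \<omega> - g \<omega>"] by (simp add: power2_sum power2_diff)
  qed (use assms in \<open>simp add: L2_def\<close>)
  also have "\<dots> = 2 * (\<integral>\<omega>. (f \<omega>)\<^sup>2 \<partial>M) + 2 * (\<integral>\<omega>. (g \<omega>)\<^sup>2 \<partial>M)"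
    using assms by (simp add: L2_def)
  finally show ?thesis .
qed

lemma sq_approx_limit:
  assumes "S \<subseteq> L2 M" and "f \<in> L2 M"
    and *: "\<And>\<epsilon>. \<epsilon> > 0 \<Longrightarrow> \<exists>h. sq_approx M S h \<and> (\<integral>\<omega>. (f \<omega> - h \<omega>)\<^sup>2 \<partial>M) < \<epsilon>"
  shows "sq_approx M S f"
  unfolding sq_approx_def
proof (intro conjI allI impI)
  fix \<epsilon> :: real assume "\<epsilon> > 0"
  \<comment> \<open>Both errors enter doubled by \<open>integral_square_add_le\<close>, so a quarter
    of \<open>\<epsilon>\<close> for each suffices.\<close>
  then obtain h where h: "sq_approx M S h" "(\<integral>\<omega>. (f \<omega> - h \<omega>)\<^sup>2 \<partial>M) < \<epsilon> / 4"
    using *[of "\<epsilon> / 4"] by auto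
  then obtain g where g: "g \<in> S" "(\<integral>\<omega>. (h \<omega> - g \<omega>)\<^sup>2 \<partial>M) < \<epsilon> / 4"
    using \<open>\<epsilon> > 0\<close> unfolding sq_approx_def by (metis divide_pos_pos zero_less_numeral)
  have "(\<integral>\<omega>. (f \<omega> - g \<omega>)\<^sup>2 \<partial>M) = (\<integral>\<omega>. ((f \<omega> - h \<omega>) + (h \<omega> - g \<omega>))\<^sup>2 \<partial>M)"
    by simp
  also have "\<dots> \<le> 2 * (\<integral>\<omega>. (f \<omega> - h \<omega>)\<^sup>2 \<partial>M) + 2 * (\<integral>\<omega>. (h \<omega> - g \<omega>)\<^sup>2 \<partial>M)"
    using assms(1,2) g(1) h(1)
    by (intro integral_square_add_le) (auto intro: L2_diff simp: sq_approx_def)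
  finally show "\<exists>g\<in>S. (\<integral>\<omega>. (f \<omega> - g \<omega>)\<^sup>2 \<partial>M) < \<epsilon>"
    using g h by (intro bexI[of _ g]) auto
qed fact

lemma sq_approx_scale:
  assumes S: "\<And>c g. g \<in> S \<Longrightarrow> (\<lambda>\<omega>. c * g \<omega>) \<in> S" and f: "sq_approx M S f"
  shows "sq_approx M S (\<lambda>\<omega>. c * f \<omega>)"
  unfolding sq_approx_def
proof (intro conjI allI impI)
  show "(\<lambda>\<omega>. c * f \<omega>) \<in> L2 M"
    using f by (auto simp: sq_approx_def intro: L2_scale)
  fix \<epsilon> :: real assume "\<epsilon> > 0"
  \<comment> \<open>Dividing by \<open>c\<^sup>2 + 1\<close> instead of \<open>c\<^sup>2\<close>
    covers \<open>c = 0\<close> as well.\<close>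
  moreover have "c\<^sup>2 + 1 > 0"
    by (simp add: add_nonneg_pos)
  ultimately obtain g where g: "g \<in> S" "(\<integral>\<omega>. (f \<omega> - g \<omega>)\<^sup>2 \<partial>M) < \<epsilon> / (c\<^sup>2 + 1)"
    using f unfolding sq_approx_def by (metis divide_pos_pos)
  have "(\<integral>\<omega>. (c * f \<omega> - c * g \<omega>)\<^sup>2 \<partial>M) = c\<^sup>2 * (\<integral>\<omega>. (f \<omega> - g \<omega>)\<^sup>2 \<partial>M)"
    by (simp add: power_mult_distrib flip: right_diff_distrib)
  also have "\<dots> \<le> (c\<^sup>2 + 1) * (\<integral>\<omega>. (f \<omega> - g \<omega>)\<^sup>2 \<partial>M)"
    by (intro mult_right_mono) auto
  also have "\<dots> < \<epsilon>"
    using g(2) \<open>c\<^sup>2 + 1 > 0\<close> by (simp add: pos_less_divide_eq mult.commute)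
  finally show "\<exists>g\<in>S. (\<integral>\<omega>. (c * f \<omega> - g \<omega>)\<^sup>2 \<partial>M) < \<epsilon>"
    using S[OF g(1)] by (intro bexI[of _ "\<lambda>\<omega>. c * g \<omega>"]) auto
qed

lemma sq_approx_add:
  assumes S: "\<And>f g. f \<in> S \<Longrightarrow> g \<in> S \<Longrightarrow> (\<lambda>\<omega>. f \<omega> + g \<omega>) \<in> S" "S \<subseteq> L2 M"
    and f: "sq_approx M S f" and g: "sq_approx M S g"
  shows "sq_approx M S (\<lambda>\<omega>. f \<omega> + g \<omega>)"
  unfolding sq_approx_def
proof (intro conjI allI impI)
  show "(\<lambda>\<omega>. f \<omega> + g \<omega>) \<in> L2 M"
    using f g by (auto simp: sq_approx_def intro: L2_add)
  fix \<epsilon> :: real assume "\<epsilon> > 0"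
  then have "\<epsilon> / 4 > 0"
    by simp
  obtain u where u: "u \<in> S" "(\<integral>\<omega>. (f \<omega> - u \<omega>)\<^sup>2 \<partial>M) < \<epsilon> / 4"
    using f \<open>\<epsilon> / 4 > 0\<close> unfolding sq_approx_def by blast
  obtain v where v: "v \<in> S" "(\<integral>\<omega>. (g \<omega> - v \<omega>)\<^sup>2 \<partial>M) < \<epsilon> / 4"
    using g \<open>\<epsilon> / 4 > 0\<close> unfolding sq_approx_def by blast
  have "(\<integral>\<omega>. (f \<omega> + g \<omega> - (u \<omega> + v \<omega>))\<^sup>2 \<partial>M) = (\<integral>\<omega>. ((f \<omega> - u \<omega>) + (g \<omega> - v \<omega>))\<^sup>2 \<partial>M)"
    by (simp add: algebra_simps)
  also have "\<dots> \<le> 2 * (\<integral>\<omega>. (f \<omega> - u \<omega>)\<^sup>2 \<partial>M) + 2 * (\<integral>\<omega>. (g \<omega> - v \<omega>)\<^sup>2 \<partial>M)"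
    using S(2) u(1) v(1) f g
    by (intro integral_square_add_le) (auto intro: L2_diff simp: sq_approx_def)
  finally show "\<exists>h\<in>S. (\<integral>\<omega>. (f \<omega> + g \<omega> - h \<omega>)\<^sup>2 \<partial>M) < \<epsilon>"
    using u v S(1)[OF u(1) v(1)] by (intro bexI[of _ "\<lambda>\<omega>. u \<omega> + v \<omega>"]) auto
qed

lemma sq_approx_cong:
  assumes "sq_approx M S f" and "\<And>\<omega>. \<omega> \<in> space M \<Longrightarrow> f \<omega> = g \<omega>"
  shows "sq_approx M S g"
proof -
  have "g \<in> L2 M"
    using assms by (auto simp: sq_approx_def L2_def cong: measurable_cong Bochner_Integration.integrable_cong)
  moreover have "(\<integral>\<omega>. (f \<omega> - h \<omega>)\<^sup>2 \<partial>M) = (\<integral>\<omega>. (g \<omega> - h \<omega>)\<^sup>2 \<partial>M)" for h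
    using assms(2) by (intro Bochner_Integration.integral_cong) auto
  ultimately show ?thesis
    using assms(1) by (simp add: sq_approx_def)
qed

context finite_measure
begin

context
  fixes G :: "'a set set"
  assumes G: "Int_stable G" "G \<subseteq> Pow (space M)" "sets M = sigma_sets (space M) G" "space M \<in> G"
begin

lemma generator_span_L2: "span_fun G indicator \<subseteq> L2 M"
  using G(3) by (auto intro!: span_fun_L2[of G indicator M] L2_indicator)

lemma sq_approx_generator_add:
  "sq_approx M (span_fun G indicator) f \<Longrightarrow> sq_approx M (span_fun G indicator) g \<Longrightarrow>
    sq_approx M (span_fun G indicator) (\<lambda>\<omega>. f \<omega> + g \<omega>)"
  by (rule sq_approx_add[OF span_fun_add generator_span_L2])

lemma sq_approx_generator_scale:
  "sq_approx M (span_fun G indicator) f \<Longrightarrow> sq_approx M (span_fun G indicator) (\<lambda>\<omega>. c * f \<omega>)"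
  by (rule sq_approx_scale[OF span_fun_scale])

lemma sq_approx_generator_base: "f \<in> span_fun G indicator \<Longrightarrow> sq_approx M (span_fun G indicator) f"
  using generator_span_L2 by (auto simp: sq_approx_def intro!: bexI[of _ f])

lemma sq_approx_generator_sum:
  "(\<And>j. j \<in> J \<Longrightarrow> sq_approx M (span_fun G indicator) (f j)) \<Longrightarrow>
    sq_approx M (span_fun G indicator) (\<lambda>\<omega>. \<Sum>j\<in>J. f j \<omega>)"
  by (induction J rule: infinite_finite_induct)
     (auto intro: sq_approx_generator_base span_fun_zero sq_approx_generator_add)

text \<open>Dynkin's argument: the sets with approximable indicator contain the intersection-stable
  generator and are closed under complements and countable disjoint unions.\<close>

lemma sq_approx_generator_indicator:
  assumes "A \<in> sets M"
  shows "sq_approx M (span_fun G indicator) (indicator A)"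
  using G(1,2) assms[unfolded G(3)]
proof (induction rule: sigma_sets_induct_disjoint)
  case (basic A)
  then show ?case
    by (intro sq_approx_generator_base span_fun_base)
next
  case empty
  then show ?case
    using sq_approx_generator_base[OF span_fun_zero] by (simp add: indicator_def[abs_def])
next
  case (compl A)
  have "sq_approx M (span_fun G indicator) (\<lambda>\<omega>. indicator (space M) \<omega> + (-1) * indicator A \<omega>)"
    by (intro sq_approx_generator_add sq_approx_generator_scale compl sq_approx_generator_base
        span_fun_base G(4))
  then show ?case
    by (rule sq_approx_cong) (auto simp: indicator_def)
next
  case (union A)
  have sets[measurable]: "A i \<in> sets M" for i
    using union G(3) by auto
  let ?U = "\<lambda>n. \<Union>i<n. A i"
  show ?case
  proof (rule sq_approx_limit[OF generator_span_L2])
    show "indicator (\<Union>(range A)) \<in> L2 M"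
      by (intro L2_indicator) auto
    fix \<epsilon> :: real assume "\<epsilon> > 0"
    \<comment> \<open>By continuity from below, the finite unions exhaust the measure of the full
      union.\<close>
    have "(\<lambda>n. measure M (?U n)) \<longlonglongrightarrow> measure M (\<Union>n. ?U n)"
      by (intro finite_Lim_measure_incseq) (auto simp: incseq_def intro: less_le_trans)
    moreover have "(\<Union>n. ?U n) = \<Union>(range A)"
      by auto
    ultimately have "\<forall>\<^sub>F n in sequentially. dist (measure M (?U n)) (measure M (\<Union>(range A))) < \<epsilon>"
      using \<open>\<epsilon> > 0\<close> by (metis tendstoD)
    then obtain n where n: "\<bar>measure M (?U n) - measure M (\<Union>(range A))\<bar> < \<epsilon>"
      by (auto simp: eventually_sequentially dist_real_def)
    have "(\<Sum>i<n. indicator (A i) \<omega>) = (indicator (?U n) \<omega> :: real)" for \<omega>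
      using union(1) by (subst indicator_UN_disjoint) (auto simp: disjoint_family_on_def)
    then have "sq_approx M (span_fun G indicator) (indicator (?U n))"
      using sq_approx_generator_sum[of "{..<n}" "\<lambda>i. indicator (A i)"] union(3) by simp
    \<comment> \<open>For nested sets the squared difference of the indicators is the indicator of
      the set difference, so the error is a difference of measures.\<close>
    moreover have "(\<integral>\<omega>. (indicator (\<Union>(range A)) \<omega> - indicator (?U n) \<omega> :: real)\<^sup>2 \<partial>M)
        = (\<integral>\<omega>. indicator (\<Union>(range A) - ?U n) \<omega> \<partial>M)"
      by (intro Bochner_Integration.integral_cong) (auto simp: indicator_def)
    moreover have "\<dots> = measure M (\<Union>(range A)) - measure M (?U n)"
      by (subst finite_measure_Diff[symmetric]) auto
    ultimately show "\<exists>h. sq_approx M (span_fun G indicator) h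
        \<and> (\<integral>\<omega>. (indicator (\<Union>(range A)) \<omega> - h \<omega>)\<^sup>2 \<partial>M) < \<epsilon>"
      using n by (intro exI[of _ "indicator (?U n)"]) auto
  qed
qed

text \<open>Simple functions are finite combinations of approximable indicators, and dominated
  convergence carries them to \<open>f\<close> in mean square.\<close>

lemma sq_approx_generator:
  assumes f: "f \<in> L2 M"
  shows "sq_approx M (span_fun G indicator) f"
proof (rule sq_approx_limit[OF generator_span_L2 f])
  fix \<epsilon> :: real assume "\<epsilon> > 0"
  have [measurable]: "f \<in> borel_measurable M"
    using f by (simp add: L2_def)
  obtain F where F: "\<forall>i. simple_function M (F i)"
      and lim: "\<forall>\<omega>\<in>space M. (\<lambda>i. F i \<omega>) \<longlonglongrightarrow> f \<omega>"
      and bound: "\<forall>i. \<forall>\<omega>\<in>space M. dist (F i \<omega>) 0 \<le> 2 * dist (f \<omega>) 0"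
    using borel_measurable_implies_sequence_metric[of f M 0] by auto
  have [measurable]: "F i \<in> borel_measurable M" for i
    using F by (intro borel_measurable_simple_function) auto
  have F_approx: "sq_approx M (span_fun G indicator) (F i)" for i
  proof -
    have "sq_approx M (span_fun G indicator)
        (\<lambda>\<omega>. \<Sum>y\<in>F i ` space M. y * indicator (F i -` {y} \<inter> space M) \<omega>)"
      by (intro sq_approx_generator_sum sq_approx_generator_scale sq_approx_generator_indicator) auto
    then show ?thesis
    proof (rule sq_approx_cong)
      fix \<omega> assume "\<omega> \<in> space M"
      have "(\<Sum>y\<in>F i ` space M. y * indicator (F i -` {y} \<inter> space M) \<omega>)
          = (\<Sum>y\<in>F i ` space M. if y = F i \<omega> then y else 0)"
        using \<open>\<omega> \<in> space M\<close> by (intro sum.cong) (auto simp: indicator_def)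
      also have "\<dots> = F i \<omega>"
        using F \<open>\<omega> \<in> space M\<close> by (subst sum.delta) (auto simp: simple_function_def)
      finally show "(\<Sum>y\<in>F i ` space M. y * indicator (F i -` {y} \<inter> space M) \<omega>) = F i \<omega>" .
    qed
  qed
  have "(\<lambda>i. \<integral>\<omega>. (f \<omega> - F i \<omega>)\<^sup>2 \<partial>M) \<longlonglongrightarrow> (\<integral>\<omega>. 0 \<partial>M)"
  \<comment> \<open>The simple functions satisfy
    \<open>\<bar>F i \<omega>\<bar> \<le> 2 * \<bar>f \<omega>\<bar>\<close>, so the difference is
    at most \<open>3 * \<bar>f \<omega>\<bar>\<close>; squaring gives the factor 9.\<close>
  proof (rule integral_dominated_convergence[where w = "\<lambda>\<omega>. 9 * (f \<omega>)\<^sup>2"])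
    show "integrable M (\<lambda>\<omega>. 9 * (f \<omega>)\<^sup>2)"
      using f by (simp add: L2_def)
    show "AE \<omega> in M. (\<lambda>i. (f \<omega> - F i \<omega>)\<^sup>2) \<longlonglongrightarrow> 0"
    proof (rule AE_I2)
      fix \<omega> assume "\<omega> \<in> space M"
      then have "(\<lambda>i. (f \<omega> - F i \<omega>)\<^sup>2) \<longlonglongrightarrow> (f \<omega> - f \<omega>)\<^sup>2"
        using lim by (intro tendsto_intros) auto
      then show "(\<lambda>i. (f \<omega> - F i \<omega>)\<^sup>2) \<longlonglongrightarrow> 0"
        by simp
    qed
    show "AE \<omega> in M. norm ((f \<omega> - F i \<omega>)\<^sup>2) \<le> 9 * (f \<omega>)\<^sup>2" for i
    proof (rule AE_I2)
      fix \<omega> assume "\<omega> \<in> space M"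
      then have "\<bar>f \<omega> - F i \<omega>\<bar> \<le> \<bar>3 * f \<omega>\<bar>"
        using bound by (auto simp: abs_mult dest!: spec[of _ i])
      then have "(f \<omega> - F i \<omega>)\<^sup>2 \<le> (3 * f \<omega>)\<^sup>2"
        by (simp only: abs_le_square_iff)
      then show "norm ((f \<omega> - F i \<omega>)\<^sup>2) \<le> 9 * (f \<omega>)\<^sup>2"
        by (simp add: power_mult_distrib)
    qed
  qed simp_all
  then have "\<forall>\<^sub>F i in sequentially. (\<integral>\<omega>. (f \<omega> - F i \<omega>)\<^sup>2 \<partial>M) < \<epsilon>"
    using \<open>\<epsilon> > 0\<close> by (intro order_tendstoD(2)) auto
  then obtain i where "(\<integral>\<omega>. (f \<omega> - F i \<omega>)\<^sup>2 \<partial>M) < \<epsilon>"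
    by (auto simp: eventually_sequentially)
  then show "\<exists>h. sq_approx M (span_fun G indicator) h \<and> (\<integral>\<omega>. (f \<omega> - h \<omega>)\<^sup>2 \<partial>M) < \<epsilon>"
    using F_approx by blast
qed

end

end

lemma L2_inner_normalize:
  "L2_inner M (L2_normalize M f) (L2_normalize M g) = L2_inner M f g / (L2_norm M f * L2_norm M g)"
  unfolding L2_inner_def L2_normalize_def by (simp only: times_divide_times_eq integral_divide_zero)

subsection \<open>The Markov measure and the inverse branches of the shift\<close>

lemma UNIV_bit: "(UNIV :: 2 set) = {0, 1}"
proof -
  have "(2 :: 2) = 0"
    by simp
  then show ?thesis
    using UNIV_2 by auto
qed

lemma bit_cases: "i = 0 \<or> i = 1" for i :: 2
  using UNIV_bit by auto

lemma sum_bit: "(\<Sum>i\<in>UNIV. f i) = f 0 + f (1 :: 2)"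
  by (simp add: UNIV_bit)

lemma in_cyl_snoc: "\<omega> \<in> cyl (x @ [j]) \<longleftrightarrow> \<omega> \<in> cyl x \<and> \<omega> !! length x = j"
  by (induction x arbitrary: \<omega>) auto

lemma in_cyl_singleton [simp]: "\<omega> \<in> cyl [j] \<longleftrightarrow> shd \<omega> = j"
  by simp

lemma in_cyl_hd: "\<omega> \<in> cyl x \<Longrightarrow> x \<noteq> [] \<Longrightarrow> shd \<omega> = hd x"
  by (cases x) auto

text \<open>The chain is kept abstract: positivity, row sums and stationarity stand in for the
  parametrised matrix, which returns only when the locale is instantiated.\<close>

locale markov_chain =
  fixes P :: "real^2^2" and \<pi> :: "real^2" and \<mu> :: "2 stream measure"
  assumes P_pos: "P $ i $ j > 0"
    and P_row: "P $ i $ 0 + P $ i $ 1 = 1"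
    and pi_pos: "\<pi> $ i > 0"
    and pi_stat: "\<pi> $ 0 * P $ 0 $ j + \<pi> $ 1 * P $ 1 $ j = \<pi> $ j"
    and markov: "markov_measure P \<pi> \<mu>"

sublocale markov_chain \<subseteq> prob_space \<mu>
  using markov by (simp add: markov_measure_def)

context markov_chain
begin

lemma sets_mu [measurable_cong, simp]: "sets \<mu> = sets (stream_space (count_space UNIV))"
  using markov by (simp add: markov_measure_def)

lemma space_mu [simp]: "space \<mu> = UNIV"
  using sets_eq_imp_space_eq[OF sets_mu] by (simp add: space_stream_space)

lemma measurable_shd_fun [measurable]: "(\<lambda>\<omega>. c (shd \<omega>)) \<in> borel_measurable \<mu>" for c :: "2 \<Rightarrow> real"
  by measurable

lemma measurable_SCons [measurable]: "(##) i \<in> \<mu> \<rightarrow>\<^sub>M \<mu>"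
  by measurable

lemma measure_cyl:
  "x \<noteq> [] \<Longrightarrow> measure \<mu> (cyl x) = \<pi> $ hd x * (\<Prod>k<length x - 1. P $ (x ! k) $ (x ! Suc k))"
  using markov by (simp add: markov_measure_def)

lemma measure_cyl_singleton: "measure \<mu> (cyl [j]) = \<pi> $ j"
  by (subst measure_cyl) auto

lemma measure_cyl_pos: "x \<noteq> [] \<Longrightarrow> measure \<mu> (cyl x) > 0"
  by (simp add: measure_cyl pi_pos P_pos prod_pos)

text \<open>The Jacobian \<open>J(i, j, \<dots>)\<close> of the Ruelle operator.\<close>

definition bwd :: "2 \<Rightarrow> 2 \<Rightarrow> real" where
  "bwd i j = \<pi> $ i * P $ i $ j / \<pi> $ j"

lemma bwd_pos: "bwd i j > 0"
  by (simp add: bwd_def P_pos pi_pos)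

text \<open>Prepending \<open>i\<close> to a word starting with \<open>j\<close> replaces the
  initial factor \<open>\<pi> $ j\<close> by \<open>\<pi> $ i * P $ i $ j\<close>.\<close>

lemma measure_cyl_Cons:
  assumes "x \<noteq> []"
  shows "measure \<mu> (cyl (i # x)) = bwd i (hd x) * measure \<mu> (cyl x)"
proof -
  obtain j y where x: "x = j # y"
    using assms by (cases x) auto
  show ?thesis
    using pi_pos[of j] by (simp add: x measure_cyl prod.lessThan_Suc_shift bwd_def del: prod.lessThan_Suc)
qed

lemma measure_cyl_snoc:
  assumes "x \<noteq> []"
  shows "measure \<mu> (cyl (x @ [j])) = measure \<mu> (cyl x) * P $ last x $ j"
  using assms
proof (induction x)
  case (Cons i x)
  show ?case
  proof (cases "x = []")
    case True
    then show ?thesis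
      using pi_pos[of j] by (simp add: measure_cyl)
  next
    case False
    then show ?thesis
      using Cons.IH by (simp add: measure_cyl_Cons)
  qed
qed simp

lemma sum_shd: "c (shd \<omega>) = (\<Sum>j\<in>UNIV. c j * indicator (cyl [j]) \<omega>)" for c :: "2 \<Rightarrow> real"
  using bit_cases[of "shd \<omega>"] by (auto simp: sum_bit indicator_def)

text \<open>The factor takes only two values, so the product is a combination of the restrictions of
  \<open>F\<close> to the cylinders of length one.\<close>

lemma integrable_shd_mult:
  fixes F :: "2 stream \<Rightarrow> real"
  assumes "integrable \<mu> F"
  shows "integrable \<mu> (\<lambda>\<omega>. c (shd \<omega>) * F \<omega>)"
proof -
  have "integrable \<mu> (\<lambda>\<omega>. \<Sum>j\<in>UNIV. c j * (F \<omega> * indicator (cyl [j]) \<omega>))"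
    using assms by (intro Bochner_Integration.integrable_sum integrable_mult_right
        integrable_real_mult_indicator) auto
  moreover have "(\<Sum>j\<in>UNIV. c j * (F \<omega> * indicator (cyl [j]) \<omega>)) = c (shd \<omega>) * F \<omega>" for \<omega>
    using sum_shd[of c \<omega>] by (simp add: mult.left_commute mult.commute flip: sum_distrib_left)
  ultimately show ?thesis
    by simp
qed

text \<open>On \<open>cyl [j]\<close> the denominator of \<open>bwd i j\<close> cancels the measure
  \<open>\<pi> $ j\<close>, and the row sum of \<open>P\<close> finishes. This is the total-mass
  case of the next lemma.\<close>

lemma nn_integral_bwd: "(\<integral>\<^sup>+\<omega>. ennreal (bwd i (shd \<omega>)) \<partial>\<mu>) = ennreal (\<pi> $ i)"
proof -
  have int: "integrable \<mu> (\<lambda>\<omega>. bwd i (shd \<omega>))"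
    using integrable_shd_mult[of "\<lambda>_. 1" "bwd i"] by simp
  have "(\<integral>\<omega>. bwd i (shd \<omega>) \<partial>\<mu>) = (\<integral>\<omega>. (\<Sum>j\<in>UNIV. bwd i j * indicator (cyl [j]) \<omega>) \<partial>\<mu>)"
    by (simp only: sum_shd[of "bwd i"])
  also have "\<dots> = (\<Sum>j\<in>UNIV. bwd i j * measure \<mu> (cyl [j]))"
    by (subst Bochner_Integration.integral_sum) (auto simp: emeasure_eq_measure)
  also have "\<dots> = (\<Sum>j\<in>UNIV. \<pi> $ i * P $ i $ j)"
    using pi_pos by (intro sum.cong) (auto simp: measure_cyl_singleton bwd_def less_le)
  also have "\<dots> = \<pi> $ i"
    by (simp add: sum_bit P_row flip: distrib_left)
  finally show ?thesis
    using int bwd_pos by (subst nn_integral_eq_integral) (auto simp: less_imp_le)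
qed

text \<open>Change of variables along the inverse branch \<open>(##) i\<close>. It suffices to
  compare both finite measures on cylinders, where the claim is
  \<open>measure_cyl_Cons\<close>.\<close>

lemma density_cyl_eq_distr:
  "density \<mu> (\<lambda>\<omega>. ennreal (indicator (cyl [i]) \<omega>))
    = distr (density \<mu> (\<lambda>\<omega>. ennreal (bwd i (shd \<omega>)))) \<mu> ((##) i)"
  (is "?D = ?R")
proof (rule measure_eqI_generator_eq[OF Int_stable_sstart[of UNIV], where \<Omega> = UNIV and A = "\<lambda>_. UNIV"])
  have gen: "sets \<mu> = sigma_sets UNIV (cyl ` lists UNIV \<union> {{}})"
    using sets_stream_space_sstart[of "UNIV :: 2 set"] by simp
  show "sets ?D = sigma_sets UNIV (cyl ` lists UNIV \<union> {{}})"
    using gen by simp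
  show "sets ?R = sigma_sets UNIV (cyl ` lists UNIV \<union> {{}})"
    using gen by simp
  show "range (\<lambda>_. UNIV) \<subseteq> cyl ` lists UNIV \<union> {{}}"
    by (auto intro!: image_eqI[of _ _ "[]"])
  have D: "emeasure ?D X = emeasure \<mu> (cyl [i] \<inter> X)" if "X \<in> sets \<mu>" for X
    using that by (subst emeasure_density) (auto simp flip: indicator_inter_arith simp: ennreal_indicator)
  show "emeasure ?D UNIV \<noteq> \<infinity>"
    using sets.top[of \<mu>] by (subst D) (simp_all add: emeasure_eq_measure)
  fix X assume "X \<in> cyl ` lists UNIV \<union> {{} :: 2 stream set}"
  then consider "X = {}" | x where "X = cyl x"
    by auto
  then show "emeasure ?D X = emeasure ?R X"
  proof cases
    case 2
    have R: "emeasure ?R X = (\<integral>\<^sup>+\<omega>. ennreal (bwd i (shd \<omega>)) * indicator ((##) i -` X) \<omega> \<partial>\<mu>)"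
    proof -
      have "(##) i -` X \<in> sets \<mu>"
        using measurable_sets[OF measurable_SCons, of X i] 2 by simp
      then show ?thesis
        using 2 by (subst emeasure_distr) (auto simp: emeasure_density)
    qed
    have one: "emeasure \<mu> (cyl [i]) = ennreal (\<pi> $ i)"
      by (simp add: emeasure_eq_measure measure_cyl_singleton)
    show ?thesis
    proof (cases x)
      \<comment> \<open>The empty word gives the whole space, and both sides have mass
        \<open>\<pi> $ i\<close>.\<close>
      case Nil
      then show ?thesis
        using one nn_integral_bwd[of i] D[of X] sets.top[of \<mu>] by (simp only: R) (simp add: 2)
    next
      case (Cons k y)
      show ?thesis
      proof (cases "k = i")
        case False
        then have "cyl [i] \<inter> X = {}" "(##) i -` X = {}"
          using 2 Cons by auto
        then show ?thesis
          using D[of X] R 2 by simp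
      next
        case True
        then have "cyl [i] \<inter> X = X" "(##) i -` X = cyl y"
          using 2 Cons by auto
        moreover have "emeasure \<mu> X = (\<integral>\<^sup>+\<omega>. ennreal (bwd i (shd \<omega>)) * indicator (cyl y) \<omega> \<partial>\<mu>)"
        \<comment> \<open>For nonempty \<open>y\<close> the density is constant on
          \<open>cyl y\<close>. For \<open>y = []\<close> it varies with the first letter, and the
          total mass is used instead.\<close>
        proof (cases "y = []")
          case True
          then show ?thesis
            using one nn_integral_bwd Cons 2 \<open>k = i\<close> by simp
        next
          case False
          have "(\<integral>\<^sup>+\<omega>. ennreal (bwd i (shd \<omega>)) * indicator (cyl y) \<omega> \<partial>\<mu>)
              = (\<integral>\<^sup>+\<omega>. ennreal (bwd i (hd y)) * indicator (cyl y) \<omega> \<partial>\<mu>)"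
            using in_cyl_hd[OF _ False] by (intro nn_integral_cong) (auto simp: indicator_def)
          also have "\<dots> = ennreal (bwd i (hd y)) * emeasure \<mu> (cyl y)"
            by (simp add: nn_integral_cmult_indicator)
          also have "\<dots> = emeasure \<mu> X"
            using False bwd_pos[of i "hd y"]
            by (simp add: emeasure_eq_measure 2 Cons \<open>k = i\<close> measure_cyl_Cons ennreal_mult)
          finally show ?thesis
            by simp
        qed
        ultimately show ?thesis
          using D[of X] R 2 by simp
      qed
    qed
  qed simp
qed auto

text \<open>Both sides are integrals against the two equal measures of
  \<open>density_cyl_eq_distr\<close>. Integrability is an equivalence because it is used from
  functions to branches and back.\<close>

lemma
  fixes F :: "2 stream \<Rightarrow> real"
  assumes [measurable]: "F \<in> borel_measurable \<mu>"
  shows integrable_cyl_iff: "integrable \<mu> (\<lambda>\<omega>. indicator (cyl [i]) \<omega> * F \<omega>) \<longleftrightarrow>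
      integrable \<mu> (\<lambda>\<omega>. bwd i (shd \<omega>) * F (i ## \<omega>))"
    and integral_cyl_eq: "(\<integral>\<omega>. indicator (cyl [i]) \<omega> * F \<omega> \<partial>\<mu>)
      = (\<integral>\<omega>. bwd i (shd \<omega>) * F (i ## \<omega>) \<partial>\<mu>)"
proof -
  let ?D = "density \<mu> (\<lambda>\<omega>. ennreal (indicator (cyl [i]) \<omega>))"
  let ?B = "density \<mu> (\<lambda>\<omega>. ennreal (bwd i (shd \<omega>)))"
  have [measurable]: "(##) i \<in> ?B \<rightarrow>\<^sub>M \<mu>"
    by simp
  have "integrable \<mu> (\<lambda>\<omega>. indicator (cyl [i]) \<omega> * F \<omega>) \<longleftrightarrow> integrable ?D F"
    by (subst integrable_density) auto
  also have "\<dots> \<longleftrightarrow> integrable ?B (\<lambda>\<omega>. F (i ## \<omega>))"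
    unfolding density_cyl_eq_distr by (subst integrable_distr_eq) auto
  also have "\<dots> \<longleftrightarrow> integrable \<mu> (\<lambda>\<omega>. bwd i (shd \<omega>) * F (i ## \<omega>))"
    using bwd_pos by (subst integrable_density) (auto simp: less_imp_le)
  finally show "integrable \<mu> (\<lambda>\<omega>. indicator (cyl [i]) \<omega> * F \<omega>) \<longleftrightarrow>
      integrable \<mu> (\<lambda>\<omega>. bwd i (shd \<omega>) * F (i ## \<omega>))" .
  have "(\<integral>\<omega>. indicator (cyl [i]) \<omega> * F \<omega> \<partial>\<mu>) = integral\<^sup>L ?D F"
    by (subst integral_density) auto
  also have "\<dots> = integral\<^sup>L ?B (\<lambda>\<omega>. F (i ## \<omega>))"
    unfolding density_cyl_eq_distr by (subst integral_distr) auto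
  also have "\<dots> = (\<integral>\<omega>. bwd i (shd \<omega>) * F (i ## \<omega>) \<partial>\<mu>)"
    using bwd_pos by (subst integral_density) (auto simp: less_imp_le)
  finally show "(\<integral>\<omega>. indicator (cyl [i]) \<omega> * F \<omega> \<partial>\<mu>)
      = (\<integral>\<omega>. bwd i (shd \<omega>) * F (i ## \<omega>) \<partial>\<mu>)" .
qed

lemma cyl_split: "(\<Sum>i\<in>UNIV. indicator (cyl [i]) \<omega> * F \<omega>) = F \<omega>" for F :: "2 stream \<Rightarrow> real"
  using bit_cases[of "shd \<omega>"] by (auto simp: sum_bit indicator_def)

lemma integrable_iff_bwd:
  fixes F :: "2 stream \<Rightarrow> real"
  assumes [measurable]: "F \<in> borel_measurable \<mu>"
  shows "integrable \<mu> F \<longleftrightarrow> (\<forall>i. integrable \<mu> (\<lambda>\<omega>. bwd i (shd \<omega>) * F (i ## \<omega>)))"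
proof -
  have "integrable \<mu> F \<longleftrightarrow> (\<forall>i. integrable \<mu> (\<lambda>\<omega>. indicator (cyl [i]) \<omega> * F \<omega>))"
  proof
    assume "integrable \<mu> F"
    then show "\<forall>i. integrable \<mu> (\<lambda>\<omega>. indicator (cyl [i]) \<omega> * F \<omega>)"
      by (auto intro!: integrable_real_mult_indicator simp: mult.commute[of "indicator _ _"])
  next
    assume "\<forall>i. integrable \<mu> (\<lambda>\<omega>. indicator (cyl [i]) \<omega> * F \<omega>)"
    then have "integrable \<mu> (\<lambda>\<omega>. \<Sum>i\<in>UNIV. indicator (cyl [i]) \<omega> * F \<omega>)"
      by (intro Bochner_Integration.integrable_sum) auto
    then show "integrable \<mu> F"
      by (simp only: cyl_split[where F = F])
  qed
  then show ?thesis
    by (simp add: integrable_cyl_iff[of F])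
qed

text \<open>The integrand on the right is \<open>ruelle P \<pi> F\<close>, so this is invariance of
  \<open>\<mu>\<close> under the dual Ruelle operator. It follows by cutting at the first letter and
  changing variables on each piece.\<close>

lemma integral_eq_bwd:
  fixes F :: "2 stream \<Rightarrow> real"
  assumes "integrable \<mu> F"
  shows "(\<integral>\<omega>. F \<omega> \<partial>\<mu>) = (\<integral>\<omega>. (\<Sum>i\<in>UNIV. bwd i (shd \<omega>) * F (i ## \<omega>)) \<partial>\<mu>)"
proof -
  have [measurable]: "F \<in> borel_measurable \<mu>"
    using assms by auto
  have int: "integrable \<mu> (\<lambda>\<omega>. bwd i (shd \<omega>) * F (i ## \<omega>))" for i
    using assms integrable_iff_bwd[of F] by auto
  then have int': "integrable \<mu> (\<lambda>\<omega>. indicator (cyl [i]) \<omega> * F \<omega>)" for i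
    by (simp add: integrable_cyl_iff[of F])
  have "(\<integral>\<omega>. F \<omega> \<partial>\<mu>) = (\<integral>\<omega>. (\<Sum>i\<in>UNIV. indicator (cyl [i]) \<omega> * F \<omega>) \<partial>\<mu>)"
    by (simp only: cyl_split[where F = F])
  also have "\<dots> = (\<Sum>i\<in>UNIV. \<integral>\<omega>. indicator (cyl [i]) \<omega> * F \<omega> \<partial>\<mu>)"
    by (intro Bochner_Integration.integral_sum int')
  also have "\<dots> = (\<Sum>i\<in>UNIV. \<integral>\<omega>. bwd i (shd \<omega>) * F (i ## \<omega>) \<partial>\<mu>)"
    by (simp only: integral_cyl_eq[of F] \<open>F \<in> borel_measurable \<mu>\<close>)
  also have "\<dots> = (\<integral>\<omega>. (\<Sum>i\<in>UNIV. bwd i (shd \<omega>) * F (i ## \<omega>)) \<partial>\<mu>)"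
    by (intro Bochner_Integration.integral_sum[symmetric] int)
  finally show ?thesis .
qed

subsection \<open>The kernel as the range of a lift\<close>

text \<open>The operator \<open>T\<close> of the introduction, with plus sign on
  \<open>cyl [0]\<close> and minus sign on \<open>cyl [1]\<close>.\<close>

definition lift :: "(2 stream \<Rightarrow> real) \<Rightarrow> 2 stream \<Rightarrow> real" where
  "lift h \<omega> = (if shd \<omega> = 0 then 1 else -1) * h (stl \<omega>) / (\<pi> $ shd \<omega> * P $ shd \<omega> $ shd (stl \<omega>))"

text \<open>The lift is isometric from \<open>L\<^sup>2(weight(x\<^sub>1) d\<mu>)\<close> to \<open>L\<^sup>2(\<mu>)\<close>.\<close>

definition weight :: "2 \<Rightarrow> real" where
  "weight j = (1 / (\<pi> $ 0 * P $ 0 $ j) + 1 / (\<pi> $ 1 * P $ 1 $ j)) / \<pi> $ j"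

lemma weight_pos: "weight j > 0"
  using pi_pos P_pos by (simp add: weight_def add_pos_pos)

lemma lift_measurable [measurable]:
  assumes [measurable]: "h \<in> borel_measurable \<mu>"
  shows "lift h \<in> borel_measurable \<mu>"
  unfolding lift_def[abs_def] by measurable

lemma lift_add: "lift (\<lambda>\<omega>. g \<omega> + h \<omega>) = (\<lambda>\<omega>. lift g \<omega> + lift h \<omega>)"
  by (simp add: lift_def fun_eq_iff add_divide_distrib distrib_left)

lemma lift_scale: "lift (\<lambda>\<omega>. c * h \<omega>) = (\<lambda>\<omega>. c * lift h \<omega>)"
  by (simp add: lift_def fun_eq_iff)

lemma lift_zero: "lift (\<lambda>\<omega>. 0) = (\<lambda>\<omega>. 0)"
  by (simp add: lift_def fun_eq_iff)

text \<open>The Jacobian cancels the denominator of the lift, so the two branches contribute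
  \<open>h \<omega> / \<pi> $ shd \<omega>\<close> with opposite signs.\<close>

lemma ruelle_lift: "ruelle P \<pi> (lift h) \<omega> = 0"
  using pi_pos P_pos by (simp add: ruelle_def lift_def sum_bit less_imp_neq[symmetric])

text \<open>The two signs multiply to 1, and the Jacobian cancels one of the two denominators
  \<open>\<pi> $ i * P $ i $ shd \<omega>\<close>.\<close>

lemma bwd_lift_mult:
  "bwd i (shd \<omega>) * (lift g (i ## \<omega>) * lift h (i ## \<omega>))
    = (1 / (\<pi> $ i * P $ i $ shd \<omega>) / \<pi> $ shd \<omega>) * (g \<omega> * h \<omega>)"
  using pi_pos P_pos by (simp add: lift_def bwd_def field_simps less_imp_neq[symmetric])

lemma sum_bwd_lift_mult:
  "(\<Sum>i\<in>UNIV. bwd i (shd \<omega>) * (lift g (i ## \<omega>) * lift h (i ## \<omega>))) = weight (shd \<omega>) * (g \<omega> * h \<omega>)"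
  unfolding bwd_lift_mult by (simp add: sum_bit weight_def add_divide_distrib distrib_right)

lemma lift_L2:
  assumes "h \<in> L2 \<mu>"
  shows "lift h \<in> L2 \<mu>"
proof -
  have [measurable]: "h \<in> borel_measurable \<mu>"
    using assms by (simp add: L2_def)
  have "integrable \<mu> (\<lambda>\<omega>. bwd i (shd \<omega>) * (lift h (i ## \<omega>) * lift h (i ## \<omega>)))" for i
    unfolding bwd_lift_mult
    by (rule integrable_shd_mult[where c = "\<lambda>j. 1 / (\<pi> $ i * P $ i $ j) / \<pi> $ j"])
       (rule L2_mult_integrable[OF assms assms])
  then have "integrable \<mu> (\<lambda>\<omega>. lift h \<omega> * lift h \<omega>)"
    by (subst integrable_iff_bwd) auto
  then show ?thesis
    by (simp add: L2_def power2_eq_square)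
qed

lemma lift_inner:
  assumes "g \<in> L2 \<mu>" and "h \<in> L2 \<mu>"
  shows "L2_inner \<mu> (lift g) (lift h) = (\<integral>\<omega>. weight (shd \<omega>) * (g \<omega> * h \<omega>) \<partial>\<mu>)"
  unfolding L2_inner_def
  by (subst integral_eq_bwd) (auto intro!: L2_mult_integrable lift_L2 assms simp only: sum_bwd_lift_mult)

lemma lift_kernel: "h \<in> L2 \<mu> \<Longrightarrow> lift h \<in> ruelle_kernel P \<pi> \<mu>"
  by (simp add: ruelle_kernel_def lift_L2 ruelle_lift)

text \<open>Branch 0 determines \<open>h\<close>, and the kernel equation then forces branch 1.
  Agreement is stated along both branches because norms are computed by
  \<open>integral_eq_bwd\<close>.\<close>

lemma kernel_lift:
  assumes \<phi>: "\<phi> \<in> ruelle_kernel P \<pi> \<mu>"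
  obtains h where "h \<in> L2 \<mu>" and "AE \<omega> in \<mu>. \<forall>i. \<phi> (i ## \<omega>) = lift h (i ## \<omega>)"
proof
  let ?h = "\<lambda>\<omega>. \<pi> $ 0 * P $ 0 $ shd \<omega> * \<phi> (0 ## \<omega>)"
  have L2: "\<phi> \<in> L2 \<mu>" and AE: "AE \<omega> in \<mu>. ruelle P \<pi> \<phi> \<omega> = 0"
    using \<phi> by (auto simp: ruelle_kernel_def)
  have [measurable]: "\<phi> \<in> borel_measurable \<mu>"
    using L2 by (simp add: L2_def)
  have "integrable \<mu> (\<lambda>\<omega>. (\<phi> \<omega>)\<^sup>2)"
    using L2 by (simp add: L2_def)
  then have "integrable \<mu> (\<lambda>\<omega>. bwd 0 (shd \<omega>) * (\<phi> (0 ## \<omega>))\<^sup>2)"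
    by (subst (asm) integrable_iff_bwd) auto
  \<comment> \<open>The new factor depends on the first letter only. It removes the Jacobian and
    supplies the square of the coefficient in \<open>?h\<close>.\<close>
  then have "integrable \<mu> (\<lambda>\<omega>. (\<pi> $ 0 * P $ 0 $ shd \<omega>)\<^sup>2 / bwd 0 (shd \<omega>)
      * (bwd 0 (shd \<omega>) * (\<phi> (0 ## \<omega>))\<^sup>2))"
    by (rule integrable_shd_mult)
  moreover have "(\<pi> $ 0 * P $ 0 $ j)\<^sup>2 / bwd 0 j * (bwd 0 j * y\<^sup>2) = (\<pi> $ 0 * P $ 0 $ j * y)\<^sup>2" for j y
    using bwd_pos[of 0 j] by (simp add: power_mult_distrib)
  ultimately have "integrable \<mu> (\<lambda>\<omega>. (?h \<omega>)\<^sup>2)"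
    by (simp only:)
  then show "?h \<in> L2 \<mu>"
    by (simp add: L2_def)
  show "AE \<omega> in \<mu>. \<forall>i. \<phi> (i ## \<omega>) = lift ?h (i ## \<omega>)"
    using AE
  proof eventually_elim
    case (elim \<omega>)
    have nz: "\<pi> $ j \<noteq> 0" "P $ i $ j \<noteq> 0" for i j
      using pi_pos[of j] P_pos[of i j] by auto
    have "(\<pi> $ 0 * P $ 0 $ shd \<omega> * \<phi> (0 ## \<omega>) + \<pi> $ 1 * P $ 1 $ shd \<omega> * \<phi> (1 ## \<omega>)) / \<pi> $ shd \<omega> = 0"
      using elim by (simp add: ruelle_def sum_bit add_divide_distrib)
    then have "\<pi> $ 0 * P $ 0 $ shd \<omega> * \<phi> (0 ## \<omega>) + \<pi> $ 1 * P $ 1 $ shd \<omega> * \<phi> (1 ## \<omega>) = 0"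
      using nz by simp
    then have "\<pi> $ 1 * P $ 1 $ shd \<omega> * \<phi> (1 ## \<omega>) = - (\<pi> $ 0 * P $ 0 $ shd \<omega> * \<phi> (0 ## \<omega>))"
      by simp
    then have "\<phi> (1 ## \<omega>) = lift ?h (1 ## \<omega>)"
      using nz by (simp add: lift_def field_simps)
    moreover have "\<phi> (0 ## \<omega>) = lift ?h (0 ## \<omega>)"
      using nz by (simp add: lift_def)
    ultimately have "\<phi> (i ## \<omega>) = lift ?h (i ## \<omega>)" for i
      using bit_cases[of i] by (elim disjE) (simp_all only:)
    then show ?case
      by blast
  qed
qed

section \<open>The Haar-type functions on cylinders\<close>

lemma e_fun_L2:
  "e_fun P \<mu> x \<in> L2 \<mu>"
proof -
  have "(\<lambda>\<omega>. a * (b * indicator (cyl y) \<omega> - c * indicator (cyl z) \<omega>)) \<in> L2 \<mu>" for a b c y z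
    by (intro L2_scale L2_diff L2_indicator) auto
  then show ?thesis
    unfolding e_fun_def[abs_def] .
qed

lemma cyl_L2: "indicator (cyl x) \<in> L2 \<mu>"
  by (intro L2_indicator) auto

lemma e_fun_eq_0: "\<omega> \<notin> cyl x \<Longrightarrow> e_fun P \<mu> x \<omega> = 0"
  by (simp add: e_fun_def in_cyl_snoc)

text \<open>Since \<open>x\<close> is nonempty, \<open>x\<close> and \<open>i # x\<close> end in the
  same letter, so besides the shift only the normalisation by the cylinder measure changes.\<close>

lemma e_fun_Cons:
  assumes "x \<noteq> []"
  shows "e_fun P \<mu> (i # x) \<omega>
    = (if shd \<omega> = i then sqrt (measure \<mu> (cyl x)) / sqrt (measure \<mu> (cyl (i # x))) * e_fun P \<mu> x (stl \<omega>) else 0)"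
  using assms measure_cyl_pos[OF assms] by (auto simp: e_fun_def indicator_def)

text \<open>By \<open>measure_cyl_Cons\<close> the ratio of cylinder measures equals the quotient
  under the root in \<open>a_fun\<close>. The two roots therefore multiply to that quotient, which
  is the coefficient of the lift.\<close>

lemma a_fun_eq_lift:
  assumes "x \<noteq> []"
  shows "a_fun P \<pi> \<mu> x = lift (\<lambda>\<omega>. \<pi> $ hd x * e_fun P \<mu> x \<omega>)"
proof
  fix \<omega> :: "2 stream"
  let ?j = "hd x"
  have "sqrt (\<pi> $ ?j / (\<pi> $ i * P $ i $ ?j)) * (sqrt (measure \<mu> (cyl x)) / sqrt (measure \<mu> (cyl (i # x))))
      = \<pi> $ ?j / (\<pi> $ i * P $ i $ ?j)" for i
  proof -
    have pos: "\<pi> $ ?j / (\<pi> $ i * P $ i $ ?j) > 0"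
      using pi_pos P_pos by simp
    have "measure \<mu> (cyl x) / measure \<mu> (cyl (i # x)) = \<pi> $ ?j / (\<pi> $ i * P $ i $ ?j)"
      using measure_cyl_pos[OF assms] by (simp add: measure_cyl_Cons[OF assms] bwd_def)
    then show ?thesis
      using pos by (simp only: flip: real_sqrt_divide) (simp only: real_sqrt_mult_self abs_of_pos)
  qed
  note coeff = this
  let ?\<sigma> = "if shd \<omega> = 0 then 1 else -1 :: real" and ?i = "shd \<omega>"
  have "a_fun P \<pi> \<mu> x \<omega> = ?\<sigma> * (sqrt (\<pi> $ ?j / (\<pi> $ ?i * P $ ?i $ ?j))
      * (sqrt (measure \<mu> (cyl x)) / sqrt (measure \<mu> (cyl (?i # x))) * e_fun P \<mu> x (stl \<omega>)))"
    using bit_cases[of "shd \<omega>"] by (auto simp: a_fun_def e_fun_Cons[OF assms])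
  also have "\<dots> = ?\<sigma> * (\<pi> $ ?j / (\<pi> $ ?i * P $ ?i $ ?j) * e_fun P \<mu> x (stl \<omega>))"
    by (simp only: coeff flip: mult.assoc)
  also have "\<dots> = lift (\<lambda>\<omega>. \<pi> $ ?j * e_fun P \<mu> x \<omega>) \<omega>"
  \<comment> \<open>On the cylinder the second letter of \<open>\<omega>\<close> is
    \<open>hd x\<close>, so the denominators agree; off it both sides vanish.\<close>
  proof (cases "stl \<omega> \<in> cyl x")
    case True
    then show ?thesis
      using in_cyl_hd[OF True assms] by (simp add: lift_def)
  qed (simp add: lift_def e_fun_eq_0)
  finally show "a_fun P \<pi> \<mu> x \<omega> = lift (\<lambda>\<omega>. \<pi> $ ?j * e_fun P \<mu> x \<omega>) \<omega>" .
qed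

text \<open>The coefficients balance the conditional masses: each half contributes
  \<open>sqrt (P $ last x $ 0 * P $ last x $ 1)\<close> up to a common factor, with opposite
  signs.\<close>

lemma integral_e_fun:
  assumes "x \<noteq> []"
  shows "(\<integral>\<omega>. e_fun P \<mu> x \<omega> \<partial>\<mu>) = 0"
proof -
  let ?p = "\<lambda>j. P $ last x $ j" and ?m = "measure \<mu> (cyl x)"
  have "sqrt (?p 1 / ?p 0) * ?p 0 = sqrt (?p 0 / ?p 1) * ?p 1"
  proof -
    have "sqrt (q / p) * p = sqrt p * sqrt q" if "p > 0" for p q :: real
    proof -
      have "sqrt (q / p) * p = sqrt (q / p) * (sqrt p * sqrt p)"
        using that by simp
      also have "\<dots> = sqrt (q / p * p) * sqrt p"
        by (simp only: real_sqrt_mult mult.assoc)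
      finally show ?thesis
        using that by simp
    qed
    from this[OF P_pos, of "?p 1" "last x" 0] this[OF P_pos, of "?p 0" "last x" 1] show ?thesis
      by (simp only: mult.commute[of "sqrt (?p 1)"])
  qed
  then have "sqrt (?p 1 / ?p 0) * (?m * ?p 0) - sqrt (?p 0 / ?p 1) * (?m * ?p 1) = 0"
    by (simp add: algebra_simps)
  moreover have "(\<integral>\<omega>. e_fun P \<mu> x \<omega> \<partial>\<mu>) = 1 / sqrt ?m *
      (sqrt (?p 1 / ?p 0) * (?m * ?p 0) - sqrt (?p 0 / ?p 1) * (?m * ?p 1))"
    unfolding e_fun_def using assms
    by (simp add: emeasure_eq_measure measure_cyl_snoc)
  ultimately show ?thesis
    by simp
qed

text \<open>The weight depends on the first letter only, so together with \<open>g\<close> it is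
  constant on the support of \<open>e_fun P \<mu> x\<close>, and the mean-zero property
  applies.\<close>

lemma e_fun_orthogonal:
  assumes "x \<noteq> []" and "\<And>\<omega>. \<omega> \<in> cyl x \<Longrightarrow> g \<omega> = c"
  shows "(\<integral>\<omega>. weight (shd \<omega>) * (g \<omega> * e_fun P \<mu> x \<omega>) \<partial>\<mu>) = 0"
proof -
  have "weight (shd \<omega>) * (g \<omega> * e_fun P \<mu> x \<omega>) = weight (hd x) * c * e_fun P \<mu> x \<omega>" for \<omega>
    using assms e_fun_eq_0[of \<omega> x] in_cyl_hd[of \<omega> x] by (cases "\<omega> \<in> cyl x") auto
  then show ?thesis
    using integral_e_fun[OF assms(1)] by (simp only: integral_mult_right_zero mult_zero_right)
qed

lemma in_cyl_iff: "\<omega> \<in> cyl x \<longleftrightarrow> (\<forall>i<length x. \<omega> !! i = x ! i)"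
  by (rule sstart_eq) simp

text \<open>Distinct words of equal length have disjoint cylinders. A longer \<open>y\<close> fixes
  the letter at position \<open>length x\<close>, which decides membership in both halves of
  \<open>cyl x\<close>.\<close>

lemma e_fun_const_on_cyl:
  assumes "length x \<le> length y" and "x \<noteq> y"
  obtains c where "\<And>\<omega>. \<omega> \<in> cyl y \<Longrightarrow> e_fun P \<mu> x \<omega> = c"
proof (cases "length x = length y")
  case True
  have "e_fun P \<mu> x \<omega> = 0" if "\<omega> \<in> cyl y" for \<omega>
  proof (rule e_fun_eq_0)
    show "\<omega> \<notin> cyl x"
      using that True assms(2) by (auto simp: in_cyl_iff intro: nth_equalityI)
  qed
  then show ?thesis
    by (rule that)
next
  case False
  have "e_fun P \<mu> x \<omega> = e_fun P \<mu> x \<eta>" if "\<omega> \<in> cyl y" "\<eta> \<in> cyl y" for \<omega> \<eta>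
  proof -
    have "\<omega> \<in> cyl (x @ [j]) \<longleftrightarrow> \<eta> \<in> cyl (x @ [j])" for j
      using that False assms(1) by (simp add: in_cyl_iff)
    then show ?thesis
      by (simp add: e_fun_def indicator_def)
  qed
  then show ?thesis
    using that by (cases "cyl y = {}") blast+
qed

text \<open>The function of the shorter word is constant on the cylinder of the longer one.\<close>

lemma e_fun_orthogonal_e_fun:
  assumes "x \<noteq> []" "y \<noteq> []" "x \<noteq> y"
  shows "(\<integral>\<omega>. weight (shd \<omega>) * (e_fun P \<mu> x \<omega> * e_fun P \<mu> y \<omega>) \<partial>\<mu>) = 0"
proof (cases "length x \<le> length y")
  case True
  then obtain c where "\<And>\<omega>. \<omega> \<in> cyl y \<Longrightarrow> e_fun P \<mu> x \<omega> = c"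
    using e_fun_const_on_cyl assms by metis
  then show ?thesis
    by (rule e_fun_orthogonal[OF assms(2)])
next
  case False
  then obtain c where "\<And>\<omega>. \<omega> \<in> cyl x \<Longrightarrow> e_fun P \<mu> y \<omega> = c"
    using e_fun_const_on_cyl[of y x] assms by auto
  from e_fun_orthogonal[OF assms(1) this] show ?thesis
    by (simp add: mult.commute[of "e_fun P \<mu> x _"])
qed

lemma e_fun_orthogonal_cyl:
  assumes "x \<noteq> []"
  shows "(\<integral>\<omega>. weight (shd \<omega>) * (indicator (cyl [j]) \<omega> * e_fun P \<mu> x \<omega>) \<partial>\<mu>) = 0"
  using assms by (intro e_fun_orthogonal[where c = "if hd x = j then 1 else 0"]) (auto dest: in_cyl_hd)

section \<open>The indexed family and its orthonormality\<close>

definition base :: "2 list + 2 \<Rightarrow> 2 stream \<Rightarrow> real" where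
  "base = case_sum (\<lambda>x \<omega>. \<pi> $ hd x * e_fun P \<mu> x \<omega>)
     (\<lambda>i \<omega>. (if i = 0 then 1 else -1) * (\<pi> $ 0 * P $ 0 $ i * \<pi> $ 1 * P $ 1 $ i) * indicator (cyl [i]) \<omega>)"

abbreviation index :: "(2 list + 2) set" where
  "index \<equiv> {x. x \<noteq> []} <+> UNIV"

abbreviation basis :: "2 list + 2 \<Rightarrow> 2 stream \<Rightarrow> real" where
  "basis \<equiv> case_sum (a_hat P \<pi> \<mu>) (a_hat_empty P \<pi> \<mu>)"

text \<open>In \<open>base (Inr i)\<close> the denominator of the lift cancels one factor
  \<open>\<pi> $ k * P $ k $ i\<close>, leaving that of the other branch. The sign for
  \<open>i = 1\<close> reflects that \<open>V2\<close> is positive on \<open>cyl [1, 1]\<close>,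
  where the lift changes sign.\<close>

lemma V_eq_lift: "(if i = 0 then V1 P \<pi> else V2 P \<pi>) = lift (base (Inr i))"
proof
  fix \<omega>
  have "\<pi> $ j \<noteq> 0" "P $ k $ j \<noteq> 0" for j k
    using pi_pos[of j] P_pos[of k j] by auto
  then show "(if i = 0 then V1 P \<pi> else V2 P \<pi>) \<omega> = lift (base (Inr i)) \<omega>"
    using bit_cases[of "shd \<omega>"] bit_cases[of i]
    by (auto simp: V1_def V2_def lift_def base_def indicator_def)
qed

lemma base_Inl: "base (Inl x) = (\<lambda>\<omega>. \<pi> $ hd x * e_fun P \<mu> x \<omega>)"
  by (simp add: base_def)

lemma base_Inr: "base (Inr i) = (\<lambda>\<omega>. (if i = 0 then 1 else -1) *
    (\<pi> $ 0 * P $ 0 $ i * \<pi> $ 1 * P $ 1 $ i) * indicator (cyl [i]) \<omega>)"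
  by (simp add: base_def)

lemma basis_eq:
  assumes "i \<in> index"
  shows "basis i = L2_normalize \<mu> (lift (base i))"
proof (cases i)
  case (Inl x)
  then show ?thesis
    using assms by (auto simp: a_hat_def a_fun_eq_lift base_Inl)
next
  case (Inr j)
  then show ?thesis
    by (simp only: sum.case a_hat_empty_def V_eq_lift)
qed

lemma base_L2: "base i \<in> L2 \<mu>"
  by (cases i) (simp_all only: base_Inl base_Inr L2_scale e_fun_L2 cyl_L2)

lemma base_orthogonal:
  assumes "i \<in> index" "j \<in> index" "i \<noteq> j"
  shows "(\<integral>\<omega>. weight (shd \<omega>) * (base i \<omega> * base j \<omega>) \<partial>\<mu>) = 0"
proof -
  have scale: "(\<integral>\<omega>. weight (shd \<omega>) * ((a * f \<omega>) * (b * g \<omega>)) \<partial>\<mu>) = 0"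
    if "(\<integral>\<omega>. weight (shd \<omega>) * (f \<omega> * g \<omega>) \<partial>\<mu>) = 0" for a b f g
  proof -
    have "(\<integral>\<omega>. weight (shd \<omega>) * ((a * f \<omega>) * (b * g \<omega>)) \<partial>\<mu>)
        = (\<integral>\<omega>. (a * b) * (weight (shd \<omega>) * (f \<omega> * g \<omega>)) \<partial>\<mu>)"
      by (simp only: mult_ac)
    then show ?thesis
      using that by (simp only: integral_mult_right_zero mult_zero_right)
  qed
  have cyl: "(\<integral>\<omega>. weight (shd \<omega>) * (indicator (cyl [k]) \<omega> * indicator (cyl [l]) \<omega>) \<partial>\<mu>) = 0"
    if "k \<noteq> l" for k l
  proof -
    have "weight (shd \<omega>) * (indicator (cyl [k]) \<omega> * indicator (cyl [l]) \<omega>) = 0" for \<omega>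
      using that by (auto simp: indicator_def)
    then show ?thesis
      by (simp only:) simp
  qed
  have cyl_e: "(\<integral>\<omega>. weight (shd \<omega>) * (e_fun P \<mu> x \<omega> * indicator (cyl [k]) \<omega>) \<partial>\<mu>) = 0"
    if "x \<noteq> []" for x k
    using e_fun_orthogonal_cyl[OF that, of k] by (simp only: mult.commute[of "e_fun P \<mu> x _"])
  show ?thesis
    \<comment> \<open>The disjoint sum gives four cases: two words, a word and a letter in either
      order, and two letters.\<close>
    using assms unfolding base_def
    by (elim PlusE)
       (simp_all only: sum.case mem_Collect_eq sum.inject, (intro scale; 
          (rule e_fun_orthogonal_e_fun e_fun_orthogonal_cyl cyl_e cyl; blast))+)
qed

text \<open>A vanishing integral of this nonnegative function would make \<open>f\<close> zero
  almost everywhere, against the positive measure of \<open>cyl x\<close>.\<close>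

lemma weighted_norm_pos:
  assumes f: "f \<in> L2 \<mu>" and x: "x \<noteq> []" and nz: "\<And>\<omega>. \<omega> \<in> cyl x \<Longrightarrow> f \<omega> \<noteq> 0"
  shows "(\<integral>\<omega>. weight (shd \<omega>) * (f \<omega> * f \<omega>) \<partial>\<mu>) > 0"
proof -
  have int: "integrable \<mu> (\<lambda>\<omega>. weight (shd \<omega>) * (f \<omega> * f \<omega>))"
    using f by (intro integrable_shd_mult L2_mult_integrable)
  have nonneg: "0 \<le> weight j * (y * y)" for j y
    using weight_pos[of j] by simp
  have "(\<integral>\<omega>. weight (shd \<omega>) * (f \<omega> * f \<omega>) \<partial>\<mu>) \<noteq> 0"
  proof
    assume "(\<integral>\<omega>. weight (shd \<omega>) * (f \<omega> * f \<omega>) \<partial>\<mu>) = 0"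
    then have "AE \<omega> in \<mu>. weight (shd \<omega>) * (f \<omega> * f \<omega>) = 0"
      using int nonneg by (subst (asm) integral_nonneg_eq_0_iff_AE) auto
    then have "AE \<omega> in \<mu>. \<omega> \<notin> cyl x"
    proof eventually_elim
      case (elim \<omega>)
      then show ?case
        using weight_pos[of "shd \<omega>"] nz[of \<omega>] by auto
    qed
    then have "measure \<mu> (cyl x) = 0"
      by (subst prob_eq_0) auto
    then show False
      using measure_cyl_pos[OF x] by simp
  qed
  moreover have "(\<integral>\<omega>. weight (shd \<omega>) * (f \<omega> * f \<omega>) \<partial>\<mu>) \<ge> 0"
    using nonneg by (intro Bochner_Integration.integral_nonneg)
  ultimately show ?thesis
    by simp
qed

text \<open>Guarantees that \<open>L2_normalize\<close> divides by a nonzero norm.\<close>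

lemma base_norm_pos:
  assumes "i \<in> index"
  shows "L2_inner \<mu> (lift (base i)) (lift (base i)) > 0"
proof -
  have "\<pi> $ j \<noteq> 0" "P $ k $ j \<noteq> 0" for j k
    using pi_pos[of j] P_pos[of k j] by auto
  note nz = this
  obtain y where "y \<noteq> []" "\<And>\<omega>. \<omega> \<in> cyl y \<Longrightarrow> base i \<omega> \<noteq> 0"
  proof (cases i)
    case (Inl x)
    then have "x \<noteq> []"
      using assms by auto
    \<comment> \<open>On \<open>cyl (x @ [0])\<close> only the first of the two terms of
      \<open>e_fun\<close> survives.\<close>
    moreover have "base i \<omega> \<noteq> 0" if "\<omega> \<in> cyl (x @ [0])" for \<omega>
      using that measure_cyl_pos[OF \<open>x \<noteq> []\<close>] nz
      by (auto simp: Inl base_def e_fun_def in_cyl_snoc indicator_def)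
    ultimately show ?thesis
      using that[of "x @ [0]"] by simp
  next
    case (Inr k)
    then show ?thesis
      using nz that[of "[k]"] by (auto simp: base_def)
  qed
  then show ?thesis
    unfolding lift_inner[OF base_L2 base_L2] by (rule weighted_norm_pos[OF base_L2])
qed

lemma basis_orthonormal:
  assumes "i \<in> index" "j \<in> index"
  shows "L2_inner \<mu> (basis i) (basis j) = (if i = j then 1 else 0)"
  using assms base_norm_pos[of i] base_orthogonal[of i j]
  by (auto simp only: basis_eq L2_inner_normalize L2_norm_def lift_inner[OF base_L2 base_L2]) 
     (auto simp: less_imp_le less_imp_neq[symmetric])

lemma basis_kernel: "i \<in> index \<Longrightarrow> basis i \<in> ruelle_kernel P \<pi> \<mu>"
proof -
  assume "i \<in> index"
  then have "basis i = lift (\<lambda>\<omega>. 1 / L2_norm \<mu> (lift (base i)) * base i \<omega>)"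
    unfolding lift_scale by (simp add: basis_eq L2_normalize_def fun_eq_iff)
  then show ?thesis
    using lift_kernel[OF L2_scale[OF base_L2]] by (simp only:)
qed

section \<open>Completeness\<close>

lemma lift_base_span:
  assumes "i \<in> index"
  shows "lift (base i) \<in> span_fun index basis"
proof -
  have "L2_norm \<mu> (lift (base i)) \<noteq> 0"
    using base_norm_pos[OF assms] by (simp add: L2_norm_def)
  then have "(\<lambda>\<omega>. L2_norm \<mu> (lift (base i)) * basis i \<omega>) = lift (base i)"
    using assms by (simp add: basis_eq L2_normalize_def fun_eq_iff)
  moreover have "(\<lambda>\<omega>. L2_norm \<mu> (lift (base i)) * basis i \<omega>) \<in> span_fun index basis"
    by (rule span_fun_scale[OF span_fun_base[OF assms]])
  ultimately show ?thesis
    by (simp only:)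
qed

lemma lift_span_cancel:
  assumes "lift (\<lambda>\<omega>. c * f \<omega>) \<in> span_fun I b" and "c \<noteq> 0"
  shows "lift f \<in> span_fun I b"
proof -
  have "(\<lambda>\<omega>. inverse c * lift (\<lambda>\<omega>. c * f \<omega>) \<omega>) = lift f"
    using assms(2) by (simp add: lift_scale fun_eq_iff)
  then show ?thesis
    using span_fun_scale[OF assms(1), of "inverse c"] by (simp only:)
qed

lemma lift_e_fun_span:
  assumes "x \<noteq> []"
  shows "lift (e_fun P \<mu> x) \<in> span_fun index basis"
proof (rule lift_span_cancel)
  show "lift (\<lambda>\<omega>. \<pi> $ hd x * e_fun P \<mu> x \<omega>) \<in> span_fun index basis"
    using lift_base_span[of "Inl x"] assms by (auto simp: base_Inl)
  show "\<pi> $ hd x \<noteq> 0"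
    using pi_pos[of "hd x"] by simp
qed

text \<open>Knowing both \<open>1\<^bsub>[x0]\<^esub> + 1\<^bsub>[x1]\<^esub> = 1\<^bsub>[x]\<^esub>\<close> and the multiple \<open>\<alpha> 1\<^bsub>[x0]\<^esub> - \<beta> 1\<^bsub>[x1]\<^esub>\<close> of \<open>e\<^bsub>[x]\<^esub>\<close>,
  with \<open>\<alpha> + \<beta> > 0\<close>, determines \<open>1\<^bsub>[x0]\<^esub>\<close> and \<open>1\<^bsub>[x1]\<^esub>\<close>.\<close>

lemma lift_cyl_span: "x \<noteq> [] \<Longrightarrow> lift (indicator (cyl x)) \<in> span_fun index basis"
proof (induction x rule: rev_nonempty_induct)
  case (single j)
  have nz: "\<pi> $ j \<noteq> 0" "P $ k $ j \<noteq> 0" for j k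
    using pi_pos[of j] P_pos[of k j] by auto
  have "Inr j \<in> index"
    by blast
  from lift_base_span[OF this] show ?case
    unfolding base_Inr by (rule lift_span_cancel) (simp add: nz)
next
  case (snoc j x)
  let ?m = "sqrt (measure \<mu> (cyl x))"
  let ?\<alpha> = "sqrt (P $ last x $ 1 / P $ last x $ 0)" and ?\<beta> = "sqrt (P $ last x $ 0 / P $ last x $ 1)"
  \<comment> \<open>These coefficients eliminate the sibling cylinder of
    \<open>cyl (x @ [j])\<close>.\<close>
  let ?\<gamma> = "if j = 0 then ?\<beta> else ?\<alpha>" and ?\<delta> = "if j = 0 then ?m else - ?m"
  have "?\<alpha> > 0" "?\<beta> > 0"
    using P_pos by simp_all
  then have nz: "?\<alpha> + ?\<beta> \<noteq> 0"
    by linarith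
  have m: "?m \<noteq> 0"
    using measure_cyl_pos[OF \<open>x \<noteq> []\<close>] by simp
  have eq: "(\<lambda>\<omega>. (?\<alpha> + ?\<beta>) * indicator (cyl (x @ [j])) \<omega>)
      = (\<lambda>\<omega>. ?\<gamma> * indicator (cyl x) \<omega> + ?\<delta> * e_fun P \<mu> x \<omega>)"
  proof
    fix \<omega>
    show "(?\<alpha> + ?\<beta>) * indicator (cyl (x @ [j])) \<omega> = ?\<gamma> * indicator (cyl x) \<omega> + ?\<delta> * e_fun P \<mu> x \<omega>"
      using m bit_cases[of j] bit_cases[of "\<omega> !! length x"]
      by (auto simp: e_fun_def in_cyl_snoc indicator_def)
  qed
  show ?case
  proof (rule lift_span_cancel[OF _ nz])
    show "lift (\<lambda>\<omega>. (?\<alpha> + ?\<beta>) * indicator (cyl (x @ [j])) \<omega>) \<in> span_fun index basis"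
      unfolding eq lift_add lift_scale using snoc
      by (intro span_fun_add span_fun_scale lift_e_fun_span) auto
  qed
qed

text \<open>Two cylinders are nested or disjoint; the empty set is added to make the family
  intersection-stable.\<close>

abbreviation cylinders :: "2 stream set set" where
  "cylinders \<equiv> cyl ` lists UNIV \<union> {{}}"

lemma lift_cylinders_span:
  assumes "g \<in> span_fun cylinders indicator"
  shows "lift g \<in> span_fun index basis"
  using assms
proof (induction rule: span_fun_induct)
  case zero
  show ?case
    by (simp add: lift_zero span_fun_zero)
next
  case (add f g)
  then show ?case
    by (simp add: lift_add span_fun_add)
next
  case (scale A c)
  have "lift (indicator A) \<in> span_fun index basis"
  proof -
    consider "A = {}" | "A = cyl []" | x where "x \<noteq> []" "A = cyl x"
    proof (cases "A = {}")
      case False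
      then obtain x where "A = cyl x"
        using scale by auto
      then show ?thesis
        using that(2,3) by (cases "x = []") blast+
    qed blast
    then show ?thesis
    proof cases
      case 1
      then show ?thesis
        using lift_zero span_fun_zero by (simp add: indicator_def[abs_def])
    next
      \<comment> \<open>The whole space, being the cylinder of the empty word, is outside
        \<open>lift_cyl_span\<close> and is split by its first letter.\<close>
      case 2
      have "indicator A = (\<lambda>\<omega>. indicator (cyl [0]) \<omega> + indicator (cyl [1]) \<omega> :: real)"
      proof
        fix \<omega> show "indicator A \<omega> = (indicator (cyl [0]) \<omega> + indicator (cyl [1]) \<omega> :: real)"
          using bit_cases[of "shd \<omega>"] by (auto simp: 2 indicator_def)
      qed
      then show ?thesis
        by (simp add: lift_add span_fun_add lift_cyl_span)
    next
      case 3
      then show ?thesis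
        by (simp add: lift_cyl_span)
    qed
  qed
  then show ?case
    by (simp add: lift_scale span_fun_scale)
qed

lemma cylinders_dense:
  assumes "h \<in> L2 \<mu>"
  shows "sq_approx \<mu> (span_fun cylinders indicator) h"
proof (rule sq_approx_generator[OF _ _ _ _ assms])
  show "Int_stable cylinders"
    by (rule Int_stable_sstart)
  show "sets \<mu> = sigma_sets (space \<mu>) cylinders"
    using sets_stream_space_sstart[of "UNIV :: 2 set"] by simp
  show "space \<mu> \<in> cylinders"
    by (auto intro!: image_eqI[of _ _ "[]"])
qed auto

text \<open>Approximating the preimage \<open>h\<close> by a cylinder function \<open>g\<close>
  suffices: the squared error of \<open>lift g\<close> is a weighted squared error of
  \<open>g\<close>, and the weight is bounded.\<close>

lemma basis_complete:
  assumes \<phi>: "\<phi> \<in> ruelle_kernel P \<pi> \<mu>" and "\<epsilon> > 0"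
  shows "\<exists>u\<in>span_fun index basis. L2_norm \<mu> (\<lambda>\<omega>. \<phi> \<omega> - u \<omega>) < \<epsilon>"
proof -
  \<comment> \<open>Both values of the weight are positive, so their sum bounds each of
    them.\<close>
  define K where "K = weight 0 + weight 1"
  have K: "K > 0" "weight j \<le> K" for j
    using bit_cases[of j] weight_pos[of 0] weight_pos[of 1] by (auto simp: K_def)
  obtain h where h: "h \<in> L2 \<mu>" "AE \<omega> in \<mu>. \<forall>i. \<phi> (i ## \<omega>) = lift h (i ## \<omega>)"
    using kernel_lift[OF \<phi>] by blast
  have "\<epsilon>\<^sup>2 / K > 0"
    using \<open>\<epsilon> > 0\<close> K(1) by simp
  then obtain g where g: "g \<in> span_fun cylinders indicator" "(\<integral>\<omega>. (h \<omega> - g \<omega>)\<^sup>2 \<partial>\<mu>) < \<epsilon>\<^sup>2 / K"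
    using cylinders_dense[OF h(1)] unfolding sq_approx_def by blast
  have gL2: "g \<in> L2 \<mu>"
    using g(1) by (rule span_fun_L2[rotated]) (auto intro: L2_indicator)
  let ?d = "\<lambda>\<omega>. h \<omega> - g \<omega>" and ?D = "\<lambda>\<omega>. \<phi> \<omega> - lift g \<omega>"
  have dL2: "?d \<in> L2 \<mu>"
    using h(1) gL2 by (rule L2_diff)
  have "\<phi> \<in> L2 \<mu>"
    using \<phi> by (simp add: ruelle_kernel_def)
  then have DL2: "?D \<in> L2 \<mu>"
    using gL2 by (intro L2_diff lift_L2)
  have lift_d: "lift ?d = (\<lambda>\<omega>. lift h \<omega> - lift g \<omega>)"
    by (simp add: lift_def fun_eq_iff diff_divide_distrib right_diff_distrib)
  have [measurable]: "?d \<in> borel_measurable \<mu>" "?D \<in> borel_measurable \<mu>"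
    using dL2 DL2 by (simp_all add: L2_def)
  have "L2_inner \<mu> ?D ?D = (\<integral>\<omega>. (\<Sum>i\<in>UNIV. bwd i (shd \<omega>) * (?D (i ## \<omega>) * ?D (i ## \<omega>))) \<partial>\<mu>)"
    unfolding L2_inner_def by (rule integral_eq_bwd) (rule L2_mult_integrable[OF DL2 DL2])
  \<comment> \<open>Along almost every pair of branches \<open>\<phi>\<close> may be replaced by
    \<open>lift h\<close>, and then the isometry identity applies to \<open>h - g\<close>.\<close>
  also have "\<dots> = (\<integral>\<omega>. weight (shd \<omega>) * (?d \<omega> * ?d \<omega>) \<partial>\<mu>)"
  proof (rule integral_cong_AE)
    show "AE \<omega> in \<mu>. (\<Sum>i\<in>UNIV. bwd i (shd \<omega>) * (?D (i ## \<omega>) * ?D (i ## \<omega>)))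
        = weight (shd \<omega>) * (?d \<omega> * ?d \<omega>)"
      using h(2)
    proof eventually_elim
      case (elim \<omega>)
      then show ?case
        using sum_bwd_lift_mult[of \<omega> ?d ?d] unfolding lift_d by simp
    qed
  qed measurable
  also have "\<dots> \<le> (\<integral>\<omega>. K * (?d \<omega> * ?d \<omega>) \<partial>\<mu>)"
    using K by (intro integral_mono integrable_shd_mult integrable_mult_right
        L2_mult_integrable dL2 mult_right_mono) auto
  also have "\<dots> = K * (\<integral>\<omega>. (?d \<omega>)\<^sup>2 \<partial>\<mu>)"
    by (simp add: power2_eq_square)
  also have "\<dots> < \<epsilon>\<^sup>2"
    using g(2) K(1) by (simp add: pos_less_divide_eq mult.commute)
  finally have "L2_norm \<mu> ?D < \<epsilon>"
    using \<open>\<epsilon> > 0\<close> unfolding L2_norm_def by (intro real_less_lsqrt) auto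
  then show ?thesis
    using lift_cylinders_span[OF g(1)] by blast
qed

lemma orthonormal_basis: "L2_orthonormal_basis \<mu> (ruelle_kernel P \<pi> \<mu>) index basis"
  unfolding L2_orthonormal_basis_def
proof (intro conjI ballI allI impI)
  show "ruelle_kernel P \<pi> \<mu> \<subseteq> L2 \<mu>"
    by (auto simp: ruelle_kernel_def)
next
  fix \<phi> and \<epsilon> :: real assume "\<phi> \<in> ruelle_kernel P \<pi> \<mu>" "\<epsilon> > 0"
  then show "\<exists>F c. finite F \<and> F \<subseteq> index \<and> L2_norm \<mu> (\<lambda>\<omega>. \<phi> \<omega> - (\<Sum>i\<in>F. c i * basis i \<omega>)) < \<epsilon>"
  proof -
    obtain u where u: "u \<in> span_fun index basis" "L2_norm \<mu> (\<lambda>\<omega>. \<phi> \<omega> - u \<omega>) < \<epsilon>"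
      using basis_complete[OF \<open>\<phi> \<in> ruelle_kernel P \<pi> \<mu>\<close> \<open>\<epsilon> > 0\<close>] by blast
    then obtain F c where "finite F" "F \<subseteq> index" "u = (\<lambda>\<omega>. \<Sum>i\<in>F. c i * basis i \<omega>)"
      unfolding span_fun_def by auto
    with u(2) show ?thesis
      by (intro exI[of _ F] exI[of _ c]) simp
  qed
qed (simp_all only: basis_kernel basis_orthonormal)

end

section \<open>Instantiation at the two-state transition matrix\<close>

lemma markov_chain_trans_mat:
  assumes r: "r \<in> {0<..<1}" and s: "s \<in> {0<..<1}"
    and P: "P = trans_mat r s" and \<pi>: "stationary P \<pi>" and \<mu>: "markov_measure P \<pi> \<mu>"
  shows "markov_chain P \<pi> \<mu>"
proof
  have P_eq: "P $ i $ j = (if i = 0 then (if j = 0 then r else 1 - r) else (if j = 0 then 1 - s else s))" for i j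
    by (simp add: P trans_mat_def)
  show P_pos: "P $ i $ j > 0" for i j
    using r s by (simp add: P_eq)
  show "P $ i $ 0 + P $ i $ 1 = 1" for i
    by (simp add: P_eq)
  have nonneg: "\<pi> $ i \<ge> 0" for i
    using \<pi> by (simp add: stationary_def)
  have total: "\<pi> $ 0 + \<pi> $ 1 = 1"
    using \<pi> by (simp add: stationary_def sum_bit)
  have "(\<pi> v* P) $ j = \<pi> $ j" for j
    using \<pi> by (simp add: stationary_def)
  then show stat: "\<pi> $ 0 * P $ 0 $ j + \<pi> $ 1 * P $ 1 $ j = \<pi> $ j" for j
    by (simp add: vector_matrix_mult_def sum_bit mult.commute)
  \<comment> \<open>Some entry of \<open>\<pi>\<close> is positive because the entries sum to 1, and
    stationarity with a positive matrix spreads positivity to every entry.\<close>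
  show "\<pi> $ j > 0" for j
  proof -
    have "\<pi> $ 0 > 0 \<or> \<pi> $ 1 > 0"
      using total nonneg[of 0] nonneg[of 1] by linarith
    then have "\<pi> $ 0 * P $ 0 $ j + \<pi> $ 1 * P $ 1 $ j > 0"
      using nonneg P_pos by (auto intro: add_pos_nonneg add_nonneg_pos simp: less_imp_le)
    then show ?thesis
      by (simp add: stat)
  qed
qed fact

theorem proposition6p13:
  fixes r s :: real and P :: "real^2^2" and \<pi> :: "real^2" and \<mu> :: "2 stream measure"
  assumes "r \<in> {0<..<1}" and "s \<in> {0<..<1}"
    and "P = trans_mat r s"
    and "stationary P \<pi>"
    and "markov_measure P \<pi> \<mu>"
  shows "L2_orthonormal_basis \<mu> (ruelle_kernel P \<pi> \<mu>)
           ({x. x \<noteq> []} <+> UNIV) (case_sum (a_hat P \<pi> \<mu>) (a_hat_empty P \<pi> \<mu>))"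
  by (rule markov_chain.orthonormal_basis[OF markov_chain_trans_mat[OF assms]])

end
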